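(* Let $d\in\{2,3,\dots\}\cup\{\infty\}$, and let $\underline{A}=(A_1,\dots,A_d)$ and $\underline{B}=(B_1,\dots,B_d)$ be ergodic coisometric row contractions on complex separable Hilbert spaces $\mathcal{H}_A$ and $\mathcal{H}_B$ respectively. Suppose there are unit vectors $\Omega_A\in\mathcal{H}_A$, $\Omega_B\in\mathcal{H}_B$ and a single tuple $\underline{\omega}=(\omega_1,\dots,\omega_d)$ of complex numbers with $\sum_i|\omega_i|^2=1$ such that $A_i^*\Omega_A=\overline{\omega}_i\Omega_A$ and $B_i^*\Omega_B=\overline{\omega}_i\Omega_B$ for all $i=1,\dots,d$. Let $\hat\theta_A:\mathcal{D}_A\to\Gamma(\mathbb{C}^d)\otimes\mathcal{D}_\omega$ and $\hat\theta_B:\mathcal{D}_B\to\Gamma(\mathbb{C}^d)\otimes\mathcal{D}_\omega$ be their extended characteristic functions. Then $\hat\theta_A$ and $\hat\theta_B$ are equivalent (i.e. there is a unitary $V:\mathcal{D}_A\to\mathcal{D}_B$ with $\hat\theta_A=\hat\theta_B V$) if and only if $\underline{A}$ and $\underline{B}$ are unitarily equivalent (i.e. there is a unitary $U:\mathcal{H}_A\to\mathcal{H}_B$ with $UA_i=B_iU$ for $i=1,\dots,d$).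
   Context: Inner products are linear in the second argument. If $d=\infty$, infinite sums of operators are taken in the strong operator topology and $\mathbb{C}^d$ means $\ell^2(\mathbb{N})$. A tuple $\underline{A}=(A_1,\dots,A_d)$ of bounded operators on $\mathcal{H}$ is a coisometric row contraction if $\sum_i A_iA_i^*=\mathbf{1}$; it is ergodic if the map $Z(x)=\sum_iA_ixA_i^*$ on $B(\mathcal{H})$ has only the scalar multiples of $\mathbf{1}$ as fixed points. Fock space: $\Gamma(\mathbb{C}^d)=\mathbb{C}e_0\oplus\mathbb{C}^d\oplus(\mathbb{C}^d)^{\otimes2}\oplus\cdots$ with vacuum vector $e_0$; $e_1,\dots,e_d$ is the standard orthonormal basis of $\mathbb{C}^d$ and $L_ix=e_i\otimes x$ (with $L_ie_0=e_i$) are the left creation operators. Minimal isometric dilation: for a coisometric row contraction $\underline{A}$ on $\mathcal{H}$ let $D_A=(\mathbf{1}-\underline{A}^*\underline{A})^{1/2}$ on $\bigoplus_{i=1}^d\mathcal{H}$, where $\underline{A}:\bigoplus_{i=1}^d\mathcal{H}\to\mathcal{H}$ is the row operator. $D_A$ is a projection; $\mathcal{D}_A$ denotes its range. Popescu's minimal isometric dilation $\underline{V}=(V_1,\dots,V_d)$ of $\underline{A}$ acts on $\mathcal{H}\oplus(\Gamma(\mathbb{C}^d)\otimes\mathcal{D}_A)$ by $$V_i(h\oplus\xi)=A_ih\oplus\big[e_0\otimes D_A(0,\dots,0,h,0,\dots,0)+(L_i\otimes\mathbf{1})\xi\big],$$ with $h$ in the $i$-th position. Applying the same construction to the row $\underline{\omega}:\mathbb{C}^d\to\mathbb{C}$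 (operators $\omega_i$ on the one-dimensional space $\mathbb{C}$) gives isometries $\tilde V_i$ on $\mathbb{C}\oplus(\Gamma(\mathbb{C}^d)\otimes\mathcal{D}_\omega)$, where $\mathcal{D}_\omega=\mathbb{C}^d\ominus\mathbb{C}(\overline{\omega}_1,\dots,\overline{\omega}_d)^T$. Extended characteristic function: if $\underline{A}$ is ergodic and coisometric with $A_i^*\Omega=\overline{\omega}_i\Omega$ for a unit vector $\Omega\in\mathcal{H}$, there is a unique unitary $W:\mathcal{H}\oplus(\Gamma(\mathbb{C}^d)\otimes\mathcal{D}_A)\to\mathbb{C}\oplus(\Gamma(\mathbb{C}^d)\otimes\mathcal{D}_\omega)$ with $WV_i=\tilde V_iW$ for all $i$ and $W\Omega=1\in\mathbb{C}$. It maps $\Gamma(\mathbb{C}^d)\otimes\mathcal{D}_A$ into $\Gamma(\mathbb{C}^d)\otimes\mathcal{D}_\omega$. The extended characteristic function of $\underline{A}$ is the isometry $\hat\theta_A:\mathcal{D}_A\to\Gamma(\mathbb{C}^d)\otimes\mathcal{D}_\omega$, $\hat\theta_A(x)=W(e_0\otimes x)$. *)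

theory Defs
  imports "HOL-Analysis.Analysis" "HOL-Library.Countable"
begin

section \<open>Complex Hilbert spaces\<close>

text \<open>A complex inner product space is a real one (the real inner product being the real part of
  the complex one), so that the whole real theory stays available. The complex inner product is
  linear in the \<^emph>\<open>second\<close> argument.\<close>

class complex_vector = real_vector +
  fixes scaleC :: "complex \<Rightarrow> 'a \<Rightarrow> 'a"  (infixr \<open>*\<^sub>C\<close> 75)
  assumes scaleC_add_right: "c *\<^sub>C (x + y) = c *\<^sub>C x + c *\<^sub>C y"
    and scaleC_add_left: "(c + e) *\<^sub>C x = c *\<^sub>C x + e *\<^sub>C x"
    and scaleC_scaleC: "c *\<^sub>C e *\<^sub>C x = (c * e) *\<^sub>C x"
    and scaleC_of_real: "complex_of_real r *\<^sub>C x = r *\<^sub>R x"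

class complex_inner = complex_vector + real_inner +
  fixes cinner :: "'a \<Rightarrow> 'a \<Rightarrow> complex"
  assumes cinner_commute: "cinner x y = cnj (cinner y x)"
    and cinner_add_right: "cinner x (y + z) = cinner x y + cinner x z"
    and cinner_scaleC_right: "cinner x (c *\<^sub>C y) = c * cinner x y"
    and inner_eq_Re_cinner: "inner x y = Re (cinner x y)"

class chilbert_space = complex_inner + complete_space

lemma cinner_add_left: "cinner (x + y) z = cinner x z + cinner y (z::'a::complex_inner)"
  by (metis cinner_commute cinner_add_right complex_cnj_add)

lemma cinner_scaleC_left: "cinner (c *\<^sub>C x) y = cnj c * cinner x (y::'a::complex_inner)"
  by (metis cinner_commute cinner_scaleC_right complex_cnj_mult)

lemma scaleC_zero_right [simp]: "c *\<^sub>C (0::'a::complex_vector) = 0"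
  using scaleC_add_right[of c 0 "0::'a"] by simp

lemma scaleC_zero_left [simp]: "0 *\<^sub>C (x::'a::complex_vector) = 0"
  using scaleC_of_real[of 0 x] by simp

lemma cinner_zero_right [simp]: "cinner x (0::'a::complex_inner) = 0"
  using cinner_add_right[of x 0 0] by simp

lemma cinner_zero_left [simp]: "cinner (0::'a::complex_inner) x = 0"
  using cinner_add_left[of 0 0 x] by simp

lemma cinner_self: "cinner x x = complex_of_real ((norm (x::'a::complex_inner))\<^sup>2)"
proof -
  have "Im (cinner x x) = 0"
    using arg_cong[OF cinner_commute[of x x], of Im] by simp
  moreover have "Re (cinner x x) = (norm x)\<^sup>2"
    by (metis inner_eq_Re_cinner power2_norm_eq_inner)
  ultimately show ?thesis
    by (simp add: complex_eq_iff)
qed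

lemma norm_scaleC [simp]: "norm (c *\<^sub>C (x::'a::complex_inner)) = norm c * norm x"
proof -
  have "cinner (c *\<^sub>C x) (c *\<^sub>C x) = cnj c * c * cinner x x"
    by (simp add: cinner_scaleC_left cinner_scaleC_right)
  then have "complex_of_real ((norm (c *\<^sub>C x))\<^sup>2) = cnj c * c * complex_of_real ((norm x)\<^sup>2)"
    by (simp only: cinner_self)
  also have "\<dots> = complex_of_real ((norm c * norm x)\<^sup>2)"
    by (simp only: complex_norm_square power_mult_distrib of_real_mult mult.commute[of "cnj c" c])
  finally have "(norm (c *\<^sub>C x))\<^sup>2 = (norm c * norm x)\<^sup>2"
    using of_real_eq_iff by blast
  then show ?thesis
    by (simp add: power2_eq_iff_nonneg)
qed

lemma norm_cinner_le: "norm (cinner x y) \<le> norm x * norm (y::'a::complex_inner)"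
proof (cases "cinner x y = 0")
  case False
  define c where "c = cnj (sgn (cinner x y))"
  define n where "n = complex_of_real (norm (cinner x y))"
  have n: "cinner x y * cnj (cinner x y) = n * n" "n \<noteq> 0"
    using False by (simp_all add: n_def flip: complex_norm_square power2_eq_square)
  have "cinner x (c *\<^sub>C y) = cinner x y * cnj (cinner x y) / n"
    by (simp add: cinner_scaleC_right c_def sgn_eq n_def)
  also have "\<dots> = complex_of_real (norm (cinner x y))"
    using n by (simp add: n_def)
  finally have "cinner x (c *\<^sub>C y) = complex_of_real (norm (cinner x y))" .
  then have "norm (cinner x y) = inner x (c *\<^sub>C y)"
    by (simp add: inner_eq_Re_cinner)
  also have "\<dots> \<le> norm x * norm (c *\<^sub>C y)"
    by (rule norm_cauchy_schwarz)
  also have "\<dots> = norm x * norm y"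
    using False by (simp add: c_def norm_sgn)
  finally show ?thesis .
qed simp

instantiation complex :: chilbert_space
begin

definition scaleC_complex :: "complex \<Rightarrow> complex \<Rightarrow> complex"
  where "scaleC_complex c z = c * z"

definition cinner_complex :: "complex \<Rightarrow> complex \<Rightarrow> complex"
  where "cinner_complex z w = cnj z * w"

instance
  by standard
    (auto simp: scaleC_complex_def cinner_complex_def inner_complex_def algebra_simps
      scaleR_conv_of_real)

end

instantiation prod :: (complex_vector, complex_vector) complex_vector
begin

definition scaleC_prod :: "complex \<Rightarrow> 'a \<times> 'b \<Rightarrow> 'a \<times> 'b"
  where "scaleC_prod c z = (c *\<^sub>C fst z, c *\<^sub>C snd z)"

instance
  by standard
    (auto simp: scaleC_prod_def scaleC_add_right scaleC_add_left scaleC_scaleC scaleC_of_real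
      scaleR_prod_def)

end

instantiation prod :: (complex_inner, complex_inner) complex_inner
begin

definition cinner_prod :: "'a \<times> 'b \<Rightarrow> 'a \<times> 'b \<Rightarrow> complex"
  where "cinner_prod z w = cinner (fst z) (fst w) + cinner (snd z) (snd w)"

instance
proof
  fix x y z :: "'a \<times> 'b" and c :: complex
  show "cinner x y = cnj (cinner y x)"
    by (simp add: cinner_prod_def cinner_commute[of "fst x"] cinner_commute[of "snd x"])
  show "cinner x (y + z) = cinner x y + cinner x z"
    by (simp add: cinner_prod_def cinner_add_right)
  show "cinner x (c *\<^sub>C y) = c * cinner x y"
    by (simp add: cinner_prod_def scaleC_prod_def cinner_scaleC_right distrib_left)
  show "inner x y = Re (cinner x y)"
    by (simp add: cinner_prod_def inner_prod_def inner_eq_Re_cinner)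
qed

end

instance prod :: (chilbert_space, chilbert_space) chilbert_space ..


section \<open>Hilbert direct sums\<close>

text \<open>The type \<open>('i, 'a) ell2\<close> is the Hilbert space direct sum of copies of \<open>'a\<close> indexed by
  \<open>'i\<close>. In particular \<open>('i, complex) ell2\<close> is the space usually written $\ell^2(I)$, that is
  $\mathbb{C}^d$ when \<open>'i\<close> has $d$ elements.\<close>

typedef (overloaded) ('i, 'a) ell2 =
  "{f :: 'i \<Rightarrow> 'a::real_normed_vector. (\<lambda>i. (norm (f i))\<^sup>2) summable_on UNIV}"
  morphisms ell2_nth Abs_ell2
  by (rule exI[of _ "\<lambda>_. 0"]) simp

lemma ell2_summable: "(\<lambda>i. (norm (ell2_nth f i))\<^sup>2) summable_on UNIV"
  using ell2_nth[of f] by simp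

lemma ell2_nth_Abs:
  "(\<lambda>i. (norm (f i))\<^sup>2) summable_on UNIV \<Longrightarrow> ell2_nth (Abs_ell2 f) = f"
  by (simp add: Abs_ell2_inverse)

lemma ell2_eqI: "(\<And>i. ell2_nth f i = ell2_nth g i) \<Longrightarrow> f = g"
  by (metis ell2_nth_inject ext)

lemma ell2_summable_scale:
  fixes f :: "'i \<Rightarrow> 'a::real_normed_vector"
  assumes "(\<lambda>i. (norm (f i))\<^sup>2) summable_on UNIV" "\<And>i. norm (g i) = k * norm (f i)"
  shows "(\<lambda>i. (norm (g i))\<^sup>2) summable_on UNIV"
  by (simp add: assms power_mult_distrib summable_on_cmult_right)

lemma ell2_summable_add:
  fixes f g :: "'i \<Rightarrow> 'a::real_normed_vector"
  assumes "(\<lambda>i. (norm (f i))\<^sup>2) summable_on UNIV" "(\<lambda>i. (norm (g i))\<^sup>2) summable_on UNIV"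
  shows "(\<lambda>i. (norm (f i + g i))\<^sup>2) summable_on UNIV"
proof (rule summable_on_comparison_test)
  show "(\<lambda>i. 2 * (norm (f i))\<^sup>2 + 2 * (norm (g i))\<^sup>2) summable_on UNIV"
    by (intro summable_on_add summable_on_cmult_right assms)
  fix i
  have "(norm (f i + g i))\<^sup>2 \<le> (norm (f i) + norm (g i))\<^sup>2"
    by (simp add: norm_triangle_ineq power_mono)
  also have "\<dots> \<le> 2 * (norm (f i))\<^sup>2 + 2 * (norm (g i))\<^sup>2"
    using sum_squares_bound[of "norm (f i)" "norm (g i)"] by (simp add: power2_sum)
  finally show "(norm (f i + g i))\<^sup>2 \<le> 2 * (norm (f i))\<^sup>2 + 2 * (norm (g i))\<^sup>2" .
qed auto

lemma ell2_summable_mult: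
  "(\<lambda>i. norm (ell2_nth f i) * norm (ell2_nth g i)) summable_on UNIV"
proof (rule summable_on_comparison_test)
  show "(\<lambda>i. (norm (ell2_nth f i))\<^sup>2 + (norm (ell2_nth g i))\<^sup>2) summable_on UNIV"
    by (intro summable_on_add ell2_summable)
  fix i
  have "2 * (norm (ell2_nth f i) * norm (ell2_nth g i))
      \<le> (norm (ell2_nth f i))\<^sup>2 + (norm (ell2_nth g i))\<^sup>2"
    using sum_squares_bound[of "norm (ell2_nth f i)" "norm (ell2_nth g i)"] by simp
  then show "norm (ell2_nth f i) * norm (ell2_nth g i)
      \<le> (norm (ell2_nth f i))\<^sup>2 + (norm (ell2_nth g i))\<^sup>2"
    by (smt (verit) mult_nonneg_nonneg norm_ge_zero)
qed auto

instantiation ell2 :: (type, real_normed_vector) real_vector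
begin

definition zero_ell2 :: "('a, 'b) ell2" where "zero_ell2 = Abs_ell2 (\<lambda>_. 0)"

definition plus_ell2 :: "('a, 'b) ell2 \<Rightarrow> ('a, 'b) ell2 \<Rightarrow> ('a, 'b) ell2"
  where "plus_ell2 f g = Abs_ell2 (\<lambda>i. ell2_nth f i + ell2_nth g i)"

definition uminus_ell2 :: "('a, 'b) ell2 \<Rightarrow> ('a, 'b) ell2"
  where "uminus_ell2 f = Abs_ell2 (\<lambda>i. - ell2_nth f i)"

definition minus_ell2 :: "('a, 'b) ell2 \<Rightarrow> ('a, 'b) ell2 \<Rightarrow> ('a, 'b) ell2"
  where "minus_ell2 f g = f + (- g)"

definition scaleR_ell2 :: "real \<Rightarrow> ('a, 'b) ell2 \<Rightarrow> ('a, 'b) ell2"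
  where "scaleR_ell2 r f = Abs_ell2 (\<lambda>i. r *\<^sub>R ell2_nth f i)"

lemma ell2_nth_zero [simp]: "ell2_nth 0 i = 0"
  by (simp add: zero_ell2_def ell2_nth_Abs)

lemma ell2_nth_add [simp]: "ell2_nth (f + g) i = ell2_nth f i + ell2_nth g i"
  by (simp add: plus_ell2_def ell2_nth_Abs ell2_summable_add ell2_summable)

lemma ell2_nth_uminus [simp]: "ell2_nth (- f) i = - ell2_nth f i"
  by (simp add: uminus_ell2_def ell2_nth_Abs ell2_summable)

lemma ell2_nth_minus [simp]: "ell2_nth (f - g) i = ell2_nth f i - ell2_nth g i"
  by (simp add: minus_ell2_def)

lemma ell2_nth_scaleR [simp]: "ell2_nth (r *\<^sub>R f) i = r *\<^sub>R ell2_nth f i"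
proof -
  have "(\<lambda>i. (norm (r *\<^sub>R ell2_nth f i))\<^sup>2) summable_on UNIV"
    by (rule ell2_summable_scale[OF ell2_summable[of f], of _ "\<bar>r\<bar>"]) simp
  then show ?thesis
    by (simp only: scaleR_ell2_def ell2_nth_Abs)
qed

instance
  by standard (auto intro!: ell2_eqI simp: scaleR_add_right scaleR_add_left)

end

instantiation ell2 :: (type, complex_inner) complex_vector
begin

definition scaleC_ell2 :: "complex \<Rightarrow> ('a, 'b) ell2 \<Rightarrow> ('a, 'b) ell2"
  where "scaleC_ell2 c f = Abs_ell2 (\<lambda>i. c *\<^sub>C ell2_nth f i)"

lemma ell2_nth_scaleC [simp]: "ell2_nth (c *\<^sub>C f) i = c *\<^sub>C ell2_nth f i"
proof -
  have "(\<lambda>i. (norm (c *\<^sub>C ell2_nth f i))\<^sup>2) summable_on UNIV"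
    by (rule ell2_summable_scale[OF ell2_summable[of f], of _ "norm c"]) simp
  then show ?thesis
    by (simp only: scaleC_ell2_def ell2_nth_Abs)
qed

instance
  by standard
    (auto intro!: ell2_eqI simp: scaleC_add_right scaleC_add_left scaleC_scaleC scaleC_of_real)

end

lemma ell2_cinner_abs_summable:
  fixes f g :: "('i, 'a::complex_inner) ell2"
  shows "(\<lambda>i. norm (cinner (ell2_nth f i) (ell2_nth g i))) summable_on UNIV"
  by (rule summable_on_comparison_test[OF ell2_summable_mult[of f g]]) (auto intro: norm_cinner_le)

lemma ell2_cinner_summable:
  fixes f g :: "('i, 'a::complex_inner) ell2"
  shows "(\<lambda>i. cinner (ell2_nth f i) (ell2_nth g i)) summable_on UNIV"
  by (rule abs_summable_summable[OF ell2_cinner_abs_summable])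

instantiation ell2 :: (type, complex_inner) complex_inner
begin

definition cinner_ell2 :: "('a, 'b) ell2 \<Rightarrow> ('a, 'b) ell2 \<Rightarrow> complex"
  where "cinner_ell2 f g = (\<Sum>\<^sub>\<infinity>i. cinner (ell2_nth f i) (ell2_nth g i))"

definition inner_ell2 :: "('a, 'b) ell2 \<Rightarrow> ('a, 'b) ell2 \<Rightarrow> real"
  where "inner_ell2 f g = Re (cinner f g)"

definition norm_ell2 :: "('a, 'b) ell2 \<Rightarrow> real"
  where "norm_ell2 f = sqrt (inner f f)"

definition sgn_ell2 :: "('a, 'b) ell2 \<Rightarrow> ('a, 'b) ell2"
  where "sgn_ell2 f = f /\<^sub>R norm f"

definition dist_ell2 :: "('a, 'b) ell2 \<Rightarrow> ('a, 'b) ell2 \<Rightarrow> real"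
  where "dist_ell2 f g = norm (f - g)"

definition uniformity_ell2 :: "(('a, 'b) ell2 \<times> ('a, 'b) ell2) filter"
  where "uniformity_ell2 = (INF e\<in>{0 <..}. principal {(x, y). dist x y < e})"

definition open_ell2 :: "('a, 'b) ell2 set \<Rightarrow> bool"
  where "open_ell2 U \<longleftrightarrow> (\<forall>x\<in>U. \<forall>\<^sub>F (x', y) in uniformity. x' = x \<longrightarrow> y \<in> U)"

lemma cinner_ell2_self_norms:
  "cinner f (f::('a, 'b) ell2) = complex_of_real (\<Sum>\<^sub>\<infinity>i. (norm (ell2_nth f i))\<^sup>2)"
proof -
  have "((\<lambda>i. complex_of_real ((norm (ell2_nth f i))\<^sup>2)) has_sum
      complex_of_real (\<Sum>\<^sub>\<infinity>i. (norm (ell2_nth f i))\<^sup>2)) UNIV"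
    by (intro has_sum_of_real has_sum_infsum ell2_summable)
  then show ?thesis
    unfolding cinner_ell2_def by (simp only: cinner_self infsumI)
qed

instance
proof
  fix x y z :: "('a, 'b) ell2" and c :: complex and r :: real
  show commute: "cinner x y = cnj (cinner y x)" for x y :: "('a, 'b) ell2"
    by (simp add: cinner_ell2_def cinner_commute[of "ell2_nth x _"] flip: infsum_cnj)
  show add: "cinner x (y + z) = cinner x y + cinner x z" for x y z :: "('a, 'b) ell2"
    by (simp add: cinner_ell2_def cinner_add_right infsum_add ell2_cinner_summable)
  show scale: "cinner x (c *\<^sub>C y) = c * cinner x y" for x y :: "('a, 'b) ell2" and c
    by (simp add: cinner_ell2_def cinner_scaleC_right infsum_cmult_right')
  show "inner x y = Re (cinner x y)"
    by (simp add: inner_ell2_def)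
  show "inner x y = inner y x"
    by (simp add: inner_ell2_def commute[of x y])
  show "inner (x + y) z = inner x z + inner y z"
    by (simp add: inner_ell2_def commute[of _ z] add)
  have "inner (r *\<^sub>R x) y = Re (cinner y (complex_of_real r *\<^sub>C x))"
    by (simp add: inner_ell2_def commute[of _ y] scaleC_of_real)
  also have "\<dots> = r * inner x y"
    by (simp only: scale) (simp add: inner_ell2_def commute[of x y])
  finally show "inner (r *\<^sub>R x) y = r * inner x y" .
  have inner_self: "inner x x = (\<Sum>\<^sub>\<infinity>i. (norm (ell2_nth x i))\<^sup>2)"
    by (simp add: inner_ell2_def cinner_ell2_self_norms)
  then show "0 \<le> inner x x"
    by (simp add: infsum_nonneg)
  show "inner x x = 0 \<longleftrightarrow> x = 0"
  proof
    assume "inner x x = 0"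
    then have "(norm (ell2_nth x i))\<^sup>2 = 0" for i
      using inner_self ell2_summable[of x]
      by (intro nonneg_infsum_le_0D[where A = UNIV and f = "\<lambda>i. (norm (ell2_nth x i))\<^sup>2"]) auto
    then show "x = 0"
      by (auto intro: ell2_eqI)
  next
    assume "x = 0"
    with inner_self show "inner x x = 0"
      by simp
  qed
qed (simp_all add: norm_ell2_def sgn_ell2_def dist_ell2_def uniformity_ell2_def open_ell2_def)

end

lemma norm_ell2_sq: "(norm (f::('i, 'a::complex_inner) ell2))\<^sup>2 = (\<Sum>\<^sub>\<infinity>i. (norm (ell2_nth f i))\<^sup>2)"
  by (metis cinner_ell2_self_norms cinner_self of_real_eq_iff)

lemma ell2_finite_sum_le:
  fixes f :: "('i, 'a::complex_inner) ell2"
  assumes "finite F"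
  shows "(\<Sum>i\<in>F. (norm (ell2_nth f i))\<^sup>2) \<le> (norm f)\<^sup>2"
  unfolding norm_ell2_sq by (rule finite_sum_le_infsum) (auto intro: ell2_summable assms)

lemma norm_ell2_nth_le: "norm (ell2_nth f i) \<le> norm (f::('i, 'a::complex_inner) ell2)"
  by (rule power2_le_imp_le) (use ell2_finite_sum_le[of "{i}" f] in simp_all)

instance ell2 :: (type, chilbert_space) chilbert_space
proof
  fix X :: "nat \<Rightarrow> ('a, 'b) ell2"
  assume X: "Cauchy X"
  have "Cauchy (\<lambda>n. ell2_nth (X n) i)" for i
  proof (rule metric_CauchyI)
    fix e :: real assume "e > 0"
    then obtain N where "\<And>m n. m \<ge> N \<Longrightarrow> n \<ge> N \<Longrightarrow> dist (X m) (X n) < e"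
      using X unfolding Cauchy_def by blast
    moreover have "dist (ell2_nth (X m) i) (ell2_nth (X n) i) \<le> dist (X m) (X n)" for m n
      using norm_ell2_nth_le[of "X m - X n" i] by (simp add: dist_norm)
    ultimately show "\<exists>N. \<forall>m\<ge>N. \<forall>n\<ge>N. dist (ell2_nth (X m) i) (ell2_nth (X n) i) < e"
      by (meson le_less_trans)
  qed
  then have "\<forall>i. \<exists>l. (\<lambda>n. ell2_nth (X n) i) \<longlonglongrightarrow> l"
    by (simp add: Cauchy_convergent flip: convergent_def)
  then obtain g where g: "\<And>i. (\<lambda>n. ell2_nth (X n) i) \<longlonglongrightarrow> g i"
    by (auto dest!: choice)
  have *: "\<exists>N. \<forall>n\<ge>N. \<forall>F. finite F \<longrightarrow> (\<Sum>i\<in>F. (norm (ell2_nth (X n) i - g i))\<^sup>2) \<le> e\<^sup>2"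
    if "e > 0" for e :: real
  proof -
    obtain N where N: "\<And>m n. m \<ge> N \<Longrightarrow> n \<ge> N \<Longrightarrow> dist (X m) (X n) < e"
      using X \<open>e > 0\<close> unfolding Cauchy_def by blast
    have "(\<Sum>i\<in>F. (norm (ell2_nth (X n) i - g i))\<^sup>2) \<le> e\<^sup>2" if "finite F" "n \<ge> N" for F n
    proof (rule tendsto_upperbound)
      show "(\<lambda>m. \<Sum>i\<in>F. (norm (ell2_nth (X n) i - ell2_nth (X m) i))\<^sup>2)
          \<longlonglongrightarrow> (\<Sum>i\<in>F. (norm (ell2_nth (X n) i - g i))\<^sup>2)"
        by (intro tendsto_intros g)
      have "(\<Sum>i\<in>F. (norm (ell2_nth (X n) i - ell2_nth (X m) i))\<^sup>2) \<le> e\<^sup>2" if "m \<ge> N" for m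
      proof -
        have "(\<Sum>i\<in>F. (norm (ell2_nth (X n) i - ell2_nth (X m) i))\<^sup>2) \<le> (norm (X n - X m))\<^sup>2"
          using ell2_finite_sum_le[OF \<open>finite F\<close>, of "X n - X m"] by simp
        also have "\<dots> \<le> e\<^sup>2"
          using N[OF \<open>n \<ge> N\<close> that] by (intro power_mono) (auto simp: dist_norm)
        finally show ?thesis .
      qed
      then show "\<forall>\<^sub>F m in sequentially.
          (\<Sum>i\<in>F. (norm (ell2_nth (X n) i - ell2_nth (X m) i))\<^sup>2) \<le> e\<^sup>2"
        using eventually_sequentially by blast
    qed simp
    then show ?thesis by blast
  qed
  have diff: "(\<lambda>i. (norm (ell2_nth (X n) i - g i))\<^sup>2) summable_on UNIV"
    if "\<And>F. finite F \<Longrightarrow> (\<Sum>i\<in>F. (norm (ell2_nth (X n) i - g i))\<^sup>2) \<le> e\<^sup>2" for n e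
    using that by (intro nonneg_bdd_above_summable_on) (auto simp: bdd_above_def)
  obtain N where "\<And>F. finite F \<Longrightarrow> (\<Sum>i\<in>F. (norm (ell2_nth (X N) i - g i))\<^sup>2) \<le> 1\<^sup>2"
    using *[of 1] by auto
  then have "(\<lambda>i. (norm (g i - ell2_nth (X N) i))\<^sup>2) summable_on UNIV"
    using diff[of N 1] by (simp add: norm_minus_commute)
  from ell2_summable_add[OF this ell2_summable[of "X N"]]
  have nth_g: "ell2_nth (Abs_ell2 g) = g"
    by (intro ell2_nth_Abs) simp
  have "X \<longlonglongrightarrow> Abs_ell2 g"
  proof (rule metric_LIMSEQ_I)
    fix e :: real assume "e > 0"
    then obtain N where N: "\<And>n F. n \<ge> N \<Longrightarrow> finite F \<Longrightarrow>
        (\<Sum>i\<in>F. (norm (ell2_nth (X n) i - g i))\<^sup>2) \<le> (e/2)\<^sup>2"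
      using *[of "e/2"] by auto
    have "dist (X n) (Abs_ell2 g) < e" if "n \<ge> N" for n
    proof -
      have "(norm (X n - Abs_ell2 g))\<^sup>2 = (\<Sum>\<^sub>\<infinity>i. (norm (ell2_nth (X n) i - g i))\<^sup>2)"
        by (simp add: norm_ell2_sq nth_g)
      also have "\<dots> \<le> (e/2)\<^sup>2"
        using N[OF that] by (intro infsum_le_finite_sums diff) auto
      finally have "norm (X n - Abs_ell2 g) \<le> e/2"
        by (rule power2_le_imp_le) (use \<open>e > 0\<close> in simp)
      then show ?thesis
        using \<open>e > 0\<close> by (simp add: dist_norm)
    qed
    then show "\<exists>N. \<forall>n\<ge>N. dist (X n) (Abs_ell2 g) < e" by blast
  qed
  then show "convergent X"
    by (auto simp: convergent_def)
qed

definition ell2_single :: "'i \<Rightarrow> 'a \<Rightarrow> ('i, 'a::complex_inner) ell2"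
  where "ell2_single i x = Abs_ell2 (\<lambda>j. if j = i then x else 0)"

lemma ell2_nth_single: "ell2_nth (ell2_single i x) j = (if j = i then x else 0)"
proof -
  have "(\<lambda>j. (norm (if j = i then x else 0))\<^sup>2) summable_on UNIV"
    by (rule finite_nonzero_values_imp_summable_on, rule finite_subset[of _ "{i}"]) auto
  then show ?thesis
    by (simp add: ell2_single_def ell2_nth_Abs)
qed


section \<open>Operators\<close>

definition bounded_clinear :: "('a::complex_inner \<Rightarrow> 'b::complex_inner) \<Rightarrow> bool"
  where "bounded_clinear T \<longleftrightarrow> bounded_linear T \<and> (\<forall>c x. T (c *\<^sub>C x) = c *\<^sub>C T x)"

definition cadjoint :: "('a::complex_inner \<Rightarrow> 'b::complex_inner) \<Rightarrow> 'b \<Rightarrow> 'a"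
  where "cadjoint T = (THE S. \<forall>x y. cinner (S y) x = cinner y (T x))"

definition positive_op :: "('a::complex_inner \<Rightarrow> 'a) \<Rightarrow> bool"
  where "positive_op T \<longleftrightarrow> bounded_clinear T \<and> (\<forall>x. cinner x (T x) \<in> \<real>\<^sub>\<ge>\<^sub>0)"

definition sqrt_op :: "('a::complex_inner \<Rightarrow> 'a) \<Rightarrow> 'a \<Rightarrow> 'a"
  where "sqrt_op T = (THE S. positive_op S \<and> S \<circ> S = T)"

definition unitary_between ::
    "'a::complex_inner set \<Rightarrow> 'b::complex_inner set \<Rightarrow> ('a \<Rightarrow> 'b) \<Rightarrow> bool"
  where "unitary_between S T U \<longleftrightarrow>
    bij_betw U S T \<and>
    (\<forall>x\<in>S. \<forall>y\<in>S. U (x + y) = U x + U y) \<and>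
    (\<forall>c. \<forall>x\<in>S. U (c *\<^sub>C x) = c *\<^sub>C U x) \<and>
    (\<forall>x\<in>S. \<forall>y\<in>S. cinner (U x) (U y) = cinner x y)"


section \<open>Row contractions\<close>

text \<open>Infinite sums of operators are taken in the strong operator topology, i.e. pointwise. All
  sums below that occur for a row contraction converge unconditionally, so that no enumeration of
  the index type is needed.\<close>

definition coisometric_row :: "('i \<Rightarrow> 'a::complex_inner \<Rightarrow> 'a) \<Rightarrow> bool"
  where "coisometric_row A \<longleftrightarrow>
    (\<forall>i. bounded_clinear (A i)) \<and>
    (\<forall>x. ((\<lambda>i. A i (cadjoint (A i) x)) has_sum x) UNIV)"

definition row_map :: "('i \<Rightarrow> 'a::complex_inner \<Rightarrow> 'a) \<Rightarrow> ('a \<Rightarrow> 'a) \<Rightarrow> 'a \<Rightarrow> 'a"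
  where "row_map A X = (\<lambda>h. \<Sum>\<^sub>\<infinity>i. A i (X (cadjoint (A i) h)))"

definition ergodic_row :: "('i \<Rightarrow> 'a::complex_inner \<Rightarrow> 'a) \<Rightarrow> bool"
  where "ergodic_row A \<longleftrightarrow>
    (\<forall>X. bounded_clinear X \<and> row_map A X = X \<longrightarrow> (\<exists>c. X = (\<lambda>h. c *\<^sub>C h)))"

definition row_operator :: "('i \<Rightarrow> 'a::complex_inner \<Rightarrow> 'a) \<Rightarrow> ('i, 'a) ell2 \<Rightarrow> 'a"
  where "row_operator A \<xi> = (\<Sum>\<^sub>\<infinity>i. A i (ell2_nth \<xi> i))"

definition defect_op ::
    "('i \<Rightarrow> 'a::complex_inner \<Rightarrow> 'a) \<Rightarrow> ('i, 'a) ell2 \<Rightarrow> ('i, 'a) ell2"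
  where "defect_op A = sqrt_op (\<lambda>\<xi>. \<xi> - cadjoint (row_operator A) (row_operator A \<xi>))"

definition defect_space :: "('i \<Rightarrow> 'a::complex_inner \<Rightarrow> 'a) \<Rightarrow> ('i, 'a) ell2 set"
  where "defect_space A = range (defect_op A)"


section \<open>Full Fock space\<close>

text \<open>The Fock space $\Gamma(\mathbb{C}^d)$ has the orthonormal basis
  $e_{i_1} \otimes \cdots \otimes e_{i_n}$ indexed by the finite words $i_1 \dots i_n$ in the index
  set, the empty word giving the vacuum vector $e_0$. It is therefore rendered as
  \<open>('i list, complex) ell2\<close>, and the Hilbert space tensor product $\Gamma(\mathbb{C}^d) \otimes K$
  as \<open>('i list, K) ell2\<close>, with $u \otimes x$ given by \<open>fock_tensor u x\<close>. The operator \<open>creation i\<close>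
  prepends the letter $i$; for \<open>K = complex\<close> it is $L_i$, and in general it is
  $L_i \otimes \mathbf{1}$.\<close>

definition vacuum :: "('i list, complex) ell2"
  where "vacuum = ell2_single [] 1"

definition fock_tensor ::
    "('i list, complex) ell2 \<Rightarrow> 'k::complex_inner \<Rightarrow> ('i list, 'k) ell2"
  where "fock_tensor u x = Abs_ell2 (\<lambda>w. ell2_nth u w *\<^sub>C x)"

definition creation :: "'i \<Rightarrow> ('i list, 'k::complex_inner) ell2 \<Rightarrow> ('i list, 'k) ell2"
  where "creation i \<xi> =
    Abs_ell2 (\<lambda>w. case w of [] \<Rightarrow> 0 | j # v \<Rightarrow> if j = i then ell2_nth \<xi> v else 0)"

definition fock_over :: "'k::complex_inner set \<Rightarrow> ('i list, 'k) ell2 set"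
  where "fock_over D = {\<xi>. \<forall>w. ell2_nth \<xi> w \<in> D}"

lemma ell2_nth_fock_tensor [simp]: "ell2_nth (fock_tensor u x) w = ell2_nth u w *\<^sub>C x"
proof -
  have "(\<lambda>w. (norm (ell2_nth u w *\<^sub>C x))\<^sup>2) summable_on UNIV"
    by (rule ell2_summable_scale[OF ell2_summable[of u], of _ "norm x"]) simp
  then show ?thesis
    by (simp add: fock_tensor_def ell2_nth_Abs)
qed

lemma ell2_nth_creation:
  "ell2_nth (creation i \<xi>) w =
    (case w of [] \<Rightarrow> 0 | j # v \<Rightarrow> if j = i then ell2_nth \<xi> v else 0)"
proof -
  let ?f = "\<lambda>w. case w of [] \<Rightarrow> 0 | j # v \<Rightarrow> if j = i then ell2_nth \<xi> v else 0"
  have "(\<lambda>w. (norm (?f w))\<^sup>2) summable_on range (Cons i)"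
    by (subst summable_on_reindex) (auto simp: o_def ell2_summable)
  then have "(\<lambda>w. (norm (?f w))\<^sup>2) summable_on UNIV"
    by (rule summable_on_cong_neutral[THEN iffD1, rotated -1])
      (auto split: list.splits if_splits)
  then show ?thesis
    by (simp add: creation_def ell2_nth_Abs)
qed

lemma creation_fock_tensor: "creation i (fock_tensor u x) = fock_tensor (creation i u) x"
  by (rule ell2_eqI) (simp add: ell2_nth_creation split: list.split)

lemma cinner_fock_tensor:
  "cinner (fock_tensor u x) (fock_tensor v y) = cinner u v * cinner x y"
proof -
  have "cinner (fock_tensor u x) (fock_tensor v y) =
      (\<Sum>\<^sub>\<infinity>w. cinner (ell2_nth u w) (ell2_nth v w) * cinner x y)"
    by (simp add: cinner_ell2_def[of "fock_tensor u x"] cinner_scaleC_left cinner_scaleC_right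
        cinner_complex_def mult_ac)
  also have "\<dots> = cinner u v * cinner x y"
    by (simp only: infsum_cmult_left' cinner_ell2_def)
  finally show ?thesis .
qed


section \<open>Minimal isometric dilation and extended characteristic function\<close>

definition dilation_space ::
    "('i \<Rightarrow> 'a::complex_inner \<Rightarrow> 'a) \<Rightarrow> ('a \<times> ('i list, ('i, 'a) ell2) ell2) set"
  where "dilation_space A = UNIV \<times> fock_over (defect_space A)"

definition dilation ::
    "('i \<Rightarrow> 'a::complex_inner \<Rightarrow> 'a) \<Rightarrow> 'i
      \<Rightarrow> 'a \<times> ('i list, ('i, 'a) ell2) ell2 \<Rightarrow> 'a \<times> ('i list, ('i, 'a) ell2) ell2"
  where "dilation A i = (\<lambda>(h, \<xi>).
    (A i h, fock_tensor vacuum (defect_op A (ell2_single i h)) + creation i \<xi>))"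

text \<open>The row $\underline\omega$ as operators on the one-dimensional space $\mathbb{C}$. Its
  defect space consists of the vectors orthogonal to $(\overline\omega_i)_i$ when
  $\sum_i |\omega_i|^2 = 1$.\<close>

definition scalar_row :: "('i \<Rightarrow> complex) \<Rightarrow> 'i \<Rightarrow> complex \<Rightarrow> complex"
  where "scalar_row \<omega> i z = \<omega> i * z"

text \<open>\<open>dilation_unitary A \<Omega> \<omega>\<close> is the unitary $W$ intertwining the two dilations with
  $W\Omega = 1$. On the carrier it is uniquely determined; outside it is fixed by extensionality so
  that the definite description makes sense.\<close>

definition dilation_unitary ::
    "('i \<Rightarrow> 'a::complex_inner \<Rightarrow> 'a) \<Rightarrow> 'a \<Rightarrow> ('i \<Rightarrow> complex)
      \<Rightarrow> 'a \<times> ('i list, ('i, 'a) ell2) ell2 \<Rightarrow> complex \<times> ('i list, ('i, complex) ell2) ell2"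
  where "dilation_unitary A \<Omega> \<omega> = (THE W.
    W \<in> extensional (dilation_space A) \<and>
    unitary_between (dilation_space A) (dilation_space (scalar_row \<omega>)) W \<and>
    (\<forall>i. \<forall>z\<in>dilation_space A. W (dilation A i z) = dilation (scalar_row \<omega>) i (W z)) \<and>
    W (\<Omega>, 0) = (1, 0))"

text \<open>For \<open>x \<in> defect_space A\<close> the first component of $W(0 \oplus (e_0 \otimes x))$ vanishes, so the
  projection \<open>snd\<close> only removes the embedding of $\Gamma(\mathbb{C}^d) \otimes \mathcal{D}_\omega$ into
  $\mathbb{C} \oplus (\Gamma(\mathbb{C}^d) \otimes \mathcal{D}_\omega)$.\<close>

definition ext_char_fun ::
    "('i \<Rightarrow> 'a::complex_inner \<Rightarrow> 'a) \<Rightarrow> 'a \<Rightarrow> ('i \<Rightarrow> complex)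
      \<Rightarrow> ('i, 'a) ell2 \<Rightarrow> ('i list, ('i, complex) ell2) ell2"
  where "ext_char_fun A \<Omega> \<omega> x = snd (dilation_unitary A \<Omega> \<omega> (0, fock_tensor vacuum x))"

end

theory Submission
  imports Defs
begin

text \<open>For a word $w = i_1 \cdots i_n$ write $V_w = V_{i_1} \cdots V_{i_n}$, and let $A_w$ be the
  corresponding product for the row itself. The projection onto the closed span of the vectors
  $V_w\Omega$ commutes with all $V_i$, because $V_i^*\Omega = \overline{\omega}_i\Omega$; its
  compression to $\mathcal{H}$ is therefore a fixed point of $Z$, so ergodicity makes these vectors
  total in the dilation space. Their Gram matrix depends on $\underline\omega$ only, which yields the
  unitary $W$. Pairing $W(e_0 \otimes x)$ with the total set $\tilde V_w 1$ shows that $\hat\theta_A(x)$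
  amounts to the family of numbers $\langle A_v\Omega, x_i\rangle$.

  A unitary equivalence of the rows, normalised by a phase so that it matches the two vacuum vectors,
  preserves these numbers. Conversely, if \<open>V\<close> preserves them, then it maps $D_A(e_i \otimes A_v\Omega_A)$
  to $D_B(e_i \otimes B_v\Omega_B)$, so the components of $V_w\Omega_A$ and $V_w\Omega_B$ in Fock space
  have the same inner products. Subtracting these from the common Gram matrix shows that the total
  families $A_w\Omega_A$ and $B_w\Omega_B$ have the same Gram matrix.\<close>

section \<open>Complex inner product spaces\<close>

lemma scaleC_one [simp]: "1 *\<^sub>C (x::'a::complex_vector) = x"
  using scaleC_of_real[of 1 x] by simp

lemma scaleC_minus_right: "c *\<^sub>C (- x) = - (c *\<^sub>C (x::'a::complex_vector))"
  using scaleC_add_right[of c x "- x"] by (simp add: eq_neg_iff_add_eq_0 add.commute)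

lemma scaleC_diff_right: "c *\<^sub>C (x - y) = c *\<^sub>C x - c *\<^sub>C (y::'a::complex_vector)"
  using scaleC_add_right[of c x "- y"] by (simp add: scaleC_minus_right)

lemma cinner_minus_right: "cinner x (- y) = - cinner x (y::'a::complex_inner)"
  using cinner_add_right[of x y "- y"] by (simp add: eq_neg_iff_add_eq_0 add.commute)

lemma cinner_minus_left: "cinner (- x) y = - cinner x (y::'a::complex_inner)"
  using cinner_add_left[of x "- x" y] by (simp add: eq_neg_iff_add_eq_0 add.commute)

lemma cinner_diff_right: "cinner x (y - z) = cinner x y - cinner x (z::'a::complex_inner)"
  using cinner_add_right[of x y "- z"] by (simp add: cinner_minus_right)

lemma cinner_diff_left: "cinner (x - y) z = cinner x z - cinner y (z::'a::complex_inner)"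
  using cinner_add_left[of x "- y" z] by (simp add: cinner_minus_left)

lemma cinner_self_eq_0 [simp]: "cinner x x = 0 \<longleftrightarrow> x = (0::'a::complex_inner)"
  by (simp add: cinner_self)

lemma cinner_eq_0_commute: "cinner x y = 0 \<longleftrightarrow> cinner y (x::'a::complex_inner) = 0"
  using cinner_commute[of x y] cinner_commute[of y x] by auto

lemma cinner_eqI_left:
  assumes "\<And>x. cinner a x = cinner (b::'a::complex_inner) x"
  shows "a = b"
  using assms[of "a - b"] cinner_self_eq_0[of "a - b"] by (simp add: cinner_diff_left)

lemma cinner_eqI_right:
  assumes "\<And>x. cinner x a = cinner x (b::'a::complex_inner)"
  shows "a = b"
  using assms[of "a - b"] cinner_self_eq_0[of "a - b"] by (simp add: cinner_diff_right)

text \<open>The real part of i times a complex number is minus its imaginary part, so the second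
  hypothesis recovers the imaginary parts. This lifts facts about the real inner product to the
  complex one.\<close>

lemma cinner_eq_if_inner_eq:
  fixes x y :: "'a::complex_inner" and u v :: "'b::complex_inner"
  assumes "inner x y = inner u v" "inner x (\<i> *\<^sub>C y) = inner u (\<i> *\<^sub>C v)"
  shows "cinner x y = cinner u v"
  using assms by (simp add: inner_eq_Re_cinner cinner_scaleC_right complex_eq_iff)

lemma bounded_linear_scaleC: "bounded_linear (\<lambda>x::'a::complex_inner. c *\<^sub>C x)"
  by (rule bounded_linear_intro[where K = "norm c"])
    (simp_all add: scaleC_add_right scaleC_scaleC mult.commute flip: scaleC_of_real)

lemma bounded_linear_cinner_right: "bounded_linear (\<lambda>y::'a::complex_inner. cinner x y)"
  by (rule bounded_linear_intro[where K = "norm x"])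
    (simp_all add: cinner_add_right cinner_scaleC_right norm_cinner_le mult.commute scaleR_conv_of_real
      flip: scaleC_of_real, metis norm_cinner_le mult.commute)

lemma bounded_clinearI:
  assumes "\<And>x y. T (x + y) = T x + T y" "\<And>c x. T (c *\<^sub>C x) = c *\<^sub>C T x"
    and "\<And>x. norm (T x) \<le> norm x * K"
  shows "bounded_clinear T"
  unfolding bounded_clinear_def
  using assms by (auto intro!: bounded_linear_intro[where K = K] simp flip: scaleC_of_real)

lemma bounded_clinearD:
  assumes "bounded_clinear T"
  shows "bounded_linear T" "T (x + y) = T x + T y" "T (x - y) = T x - T y" "T 0 = 0"
    "T (c *\<^sub>C x) = c *\<^sub>C T x"
  using assms unfolding bounded_clinear_def
  by (auto simp: bounded_linear.linear linear_add linear_diff linear_0)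

lemma bounded_clinear_Pair_left: "bounded_clinear (\<lambda>h. (h, 0))"
  by (rule bounded_clinearI[where K = 1]) (auto simp: scaleC_prod_def norm_Pair)

lemma bounded_clinear_fst: "bounded_clinear fst"
  by (rule bounded_clinearI[where K = 1]) (auto simp: scaleC_prod_def norm_fst_le)

lemma bounded_clinear_snd: "bounded_clinear snd"
  by (rule bounded_clinearI[where K = 1]) (auto simp: scaleC_prod_def norm_snd_le)

lemma bounded_clinear_compose:
  assumes "bounded_clinear S" "bounded_clinear T"
  shows "bounded_clinear (\<lambda>x. S (T x))"
  using assms bounded_linear_compose[of S T] by (simp add: bounded_clinear_def)

lemma bounded_clinear_add:
  assumes "bounded_clinear S" "bounded_clinear T"
  shows "bounded_clinear (\<lambda>x. S x + T x)"
  using assms bounded_linear_add[of S T] by (simp add: bounded_clinear_def scaleC_add_right)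

lemma bounded_clinear_diff:
  assumes "bounded_clinear S" "bounded_clinear T"
  shows "bounded_clinear (\<lambda>x. S x - T x)"
  using assms bounded_linear_sub[of S T] by (simp add: bounded_clinear_def scaleC_diff_right)

lemma bounded_clinear_Pair:
  assumes "bounded_clinear S" "bounded_clinear T"
  shows "bounded_clinear (\<lambda>x. (S x, T x))"
  using assms bounded_linear_Pair[of S T] by (simp add: bounded_clinear_def scaleC_prod_def)

lemma bounded_clinear_ident: "bounded_clinear (\<lambda>x. x)"
  by (simp add: bounded_clinear_def bounded_linear_ident)

section \<open>Complex subspaces and closed complex spans\<close>

definition csubspace :: "'a::complex_vector set \<Rightarrow> bool"
  where "csubspace S \<longleftrightarrow> subspace S \<and> (\<forall>c. \<forall>x\<in>S. c *\<^sub>C x \<in> S)"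

lemma csubspaceI:
  assumes "0 \<in> S" "\<And>x y. x \<in> S \<Longrightarrow> y \<in> S \<Longrightarrow> x + y \<in> S" "\<And>c x. x \<in> S \<Longrightarrow> c *\<^sub>C x \<in> S"
  shows "csubspace S"
  using assms unfolding csubspace_def subspace_def by (metis scaleC_of_real)

lemma csubspaceD:
  assumes "csubspace S"
  shows "subspace S" "0 \<in> S" "x \<in> S \<Longrightarrow> y \<in> S \<Longrightarrow> x + y \<in> S" "x \<in> S \<Longrightarrow> y \<in> S \<Longrightarrow> x - y \<in> S"
    "x \<in> S \<Longrightarrow> c *\<^sub>C x \<in> S"
  using assms unfolding csubspace_def by (auto simp: subspace_0 subspace_add subspace_diff)

lemma csubspace_vimage:
  assumes "bounded_clinear T" "csubspace S"
  shows "csubspace (T -` S)"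
  by (rule csubspaceI) (auto simp: bounded_clinearD[OF assms(1)] csubspaceD[OF assms(2)])

lemma csubspace_orthogonal: "csubspace {y. cinner x y = 0}"
  by (rule csubspaceI) (simp_all add: cinner_add_right cinner_scaleC_right)

lemma closed_vimage_bounded_linear:
  assumes "bounded_linear T" "closed S"
  shows "closed (T -` S)"
  by (rule closed_vimage[OF assms(2) linear_continuous_on[OF assms(1)]])

lemma closed_kernel:
  assumes "bounded_linear T"
  shows "closed {x. T x = 0}"
  using closed_vimage_bounded_linear[OF assms closed_singleton[of 0]] by (simp add: vimage_def)

text \<open>\<open>span\<close> is the real span; taking all complex multiples of the generators
  first makes it the complex one.\<close>

definition closed_cspan :: "('w \<Rightarrow> 'a::complex_inner) \<Rightarrow> 'a set"
  where "closed_cspan u = closure (span {c *\<^sub>C u w |c w. True})"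

lemma closed_closed_cspan: "closed (closed_cspan u)"
  by (simp add: closed_cspan_def)

lemma in_closed_cspan: "u w \<in> closed_cspan u"
proof -
  have "1 *\<^sub>C u w \<in> {c *\<^sub>C u w |c w. True}"
    by blast
  then show ?thesis
    unfolding closed_cspan_def scaleC_one by (rule subsetD[OF closure_subset, OF span_base])
qed

text \<open>Serves as the induction principle for closed spans: a closed linear condition need only
  be checked on the generators.\<close>

lemma closed_cspan_minimal:
  assumes "csubspace S" "closed S" "\<And>w. u w \<in> S"
  shows "closed_cspan u \<subseteq> S"
  unfolding closed_cspan_def
  using assms by (intro closure_minimal span_minimal) (auto simp: csubspaceD)

lemma csubspace_closure:
  fixes S :: "'a::complex_inner set"
  assumes "csubspace S"
  shows "csubspace (closure S)"
proof (rule csubspaceI)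
  show "0 \<in> closure S"
    using csubspaceD(2)[OF assms] closure_subset by blast
next
  fix x y assume "x \<in> closure S" "y \<in> closure S"
  then obtain f g where "\<And>n. f n \<in> S" "f \<longlonglongrightarrow> x" "\<And>n. g n \<in> S" "g \<longlonglongrightarrow> y"
    unfolding closure_sequential by blast
  then show "x + y \<in> closure S"
    unfolding closure_sequential
    by (intro exI[of _ "\<lambda>n. f n + g n"]) (auto intro: tendsto_add csubspaceD(3)[OF assms])
next
  fix c x assume "x \<in> closure S"
  then obtain f where "\<And>n. f n \<in> S" "f \<longlonglongrightarrow> x"
    unfolding closure_sequential by blast
  then show "c *\<^sub>C x \<in> closure S"
    unfolding closure_sequential
    by (intro exI[of _ "\<lambda>n. c *\<^sub>C f n"])
      (auto intro: bounded_linear.tendsto[OF bounded_linear_scaleC] csubspaceD(5)[OF assms])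
qed

text \<open>Multiplication by \<open>c\<close> maps the generating set into itself, hence also its
  real span and the closure of that.\<close>

lemma csubspace_closed_cspan: "csubspace (closed_cspan u)"
proof -
  let ?E = "{c *\<^sub>C u w |c w. True}"
  have "c *\<^sub>C x \<in> span ?E" if "x \<in> span ?E" for c x
  proof -
    have "(\<lambda>x. c *\<^sub>C x) ` span ?E = span ((\<lambda>x. c *\<^sub>C x) ` ?E)"
      by (rule linear_span_image[symmetric]) (rule bounded_linear.linear[OF bounded_linear_scaleC])
    also have "\<dots> \<subseteq> span ?E"
      by (rule span_mono) (auto simp: scaleC_scaleC, metis)
    finally show ?thesis
      using that by blast
  qed
  then have "csubspace (span ?E)"
    by (simp add: csubspace_def)
  then show ?thesis
    unfolding closed_cspan_def by (rule csubspace_closure)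
qed

section \<open>Orthogonal projections and adjoints\<close>

text \<open>A minimising sequence for the distance to \<open>x\<close> is Cauchy by the
  parallelogram law. Its limit is a closest point, and orthogonality is the first-order condition
  there.\<close>

lemma real_projection_exists:
  fixes S :: "'a::{real_inner, complete_space} set"
  assumes "closed S" "subspace S"
  shows "\<exists>p\<in>S. \<forall>k\<in>S. inner (x - p) k = 0"
proof -
  let ?N = "\<lambda>k. (norm (x - k))\<^sup>2"
  define d where "d = (INF k\<in>S. ?N k)"
  have ne: "S \<noteq> {}"
    using subspace_0[OF assms(2)] by blast
  have bdd: "bdd_below (?N ` S)"
    by (rule bdd_belowI[of _ 0]) auto
  have d_le: "d \<le> ?N k" if "k \<in> S" for k
    unfolding d_def by (rule cINF_lower[OF bdd that])
  have "\<exists>k\<in>S. ?N k < d + inverse (real (Suc n))" for n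
    using cINF_less_iff[OF ne bdd, of "d + inverse (real (Suc n))"]
    by (simp add: d_def del: of_nat_Suc)
  then obtain f where fS: "\<And>n. f n \<in> S" and f: "\<And>n. ?N (f n) < d + inverse (real (Suc n))"
    by metis
  have parallelogram: "(norm (k - l))\<^sup>2 \<le> 2 * ?N k + 2 * ?N l - 4 * d" if "k \<in> S" "l \<in> S" for k l
  proof -
    have "(1/2) *\<^sub>R (k + l) \<in> S"
      using that assms(2) by (simp add: subspace_add subspace_scale)
    moreover have "(norm (k - l))\<^sup>2 = 2 * ?N k + 2 * ?N l - 4 * ?N ((1/2) *\<^sub>R (k + l))"
      by (simp add: power2_norm_eq_inner inner_simps inner_commute algebra_simps)
    ultimately show ?thesis
      using d_le by fastforce
  qed
  have "Cauchy f"
  proof (rule metric_CauchyI)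
    fix e :: real assume "e > 0"
    then obtain N where N: "inverse (real (Suc N)) < e\<^sup>2 / 4"
      using reals_Archimedean[of "e\<^sup>2 / 4"] by auto
    have "dist (f m) (f n) < e" if "m \<ge> N" "n \<ge> N" for m n
    proof -
      have "inverse (real (Suc m)) \<le> inverse (real (Suc N))" "inverse (real (Suc n)) \<le> inverse (real (Suc N))"
        using that by (simp_all add: le_imp_inverse_le)
      then have "(norm (f m - f n))\<^sup>2 < e\<^sup>2"
        using parallelogram[OF fS fS, of m n] f[of m] f[of n] N by argo
      then show ?thesis
        using \<open>e > 0\<close> by (simp add: dist_norm power_less_imp_less_base)
    qed
    then show "\<exists>N. \<forall>m\<ge>N. \<forall>n\<ge>N. dist (f m) (f n) < e" by blast
  qed
  then obtain p where p: "f \<longlonglongrightarrow> p"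
    unfolding Cauchy_convergent_iff convergent_def by blast
  have "p \<in> S"
    using closed_sequentially[OF assms(1) _ p] fS by blast
  have "?N p \<le> d + 0"
  proof (rule LIMSEQ_le)
    show "(\<lambda>n. ?N (f n)) \<longlonglongrightarrow> ?N p"
      by (intro tendsto_intros p)
    show "(\<lambda>n. d + inverse (real (Suc n))) \<longlonglongrightarrow> d + 0"
      by (intro tendsto_add tendsto_const LIMSEQ_inverse_real_of_nat)
    show "\<exists>N. \<forall>n\<ge>N. ?N (f n) \<le> d + inverse (real (Suc n))"
      using f less_imp_le by blast
  qed
  have "inner (x - p) k = 0" if "k \<in> S" for k
  proof (cases "k = 0")
    case False
    \<comment> \<open>This \<open>t\<close> minimises the squared distance from \<open>x\<close> to
      \<open>p + t *\<^sub>R k\<close>. The resulting decrease \<open>t * inner (x - p) k\<close> is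
      a nonnegative number, and minimality of \<open>p\<close> forces it to vanish.\<close>
    define t where "t = inner (x - p) k / (norm k)\<^sup>2"
    have "p + t *\<^sub>R k \<in> S"
      using \<open>p \<in> S\<close> that assms(2) by (simp add: subspace_add subspace_scale)
    then have "?N p \<le> ?N (p + t *\<^sub>R k)"
      using d_le[of "p + t *\<^sub>R k"] \<open>?N p \<le> d + 0\<close> by linarith
    also have "\<dots> = ?N p - 2 * t * inner (x - p) k + t * (t * (norm k)\<^sup>2)"
      unfolding power2_norm_eq_inner by (simp add: inner_simps inner_commute algebra_simps)
    also have "t * (norm k)\<^sup>2 = inner (x - p) k"
      using False by (simp add: t_def)
    finally have "t * inner (x - p) k \<le> 0"
      by simp
    then have "(inner (x - p) k)\<^sup>2 \<le> 0"
      using False by (auto simp: t_def divide_le_0_iff mult_le_0_iff)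
    then show ?thesis
      by simp
  qed simp
  with \<open>p \<in> S\<close> show ?thesis by blast
qed

text \<open>The orthogonal complement of the kernel of a nonzero \<open>f\<close> is a line. A
  vector \<open>z\<close> on it, suitably scaled, represents \<open>f\<close>.\<close>

lemma riesz_real:
  fixes f :: "'a::{real_inner, complete_space} \<Rightarrow> real"
  assumes "bounded_linear f"
  shows "\<exists>y. \<forall>x. inner y x = f x"
proof (cases "\<forall>x. f x = 0")
  case True
  then show ?thesis by (intro exI[of _ 0]) simp
next
  case False
  then obtain x0 where x0: "f x0 \<noteq> 0" by blast
  interpret bounded_linear f by (rule assms)
  have "subspace {x. f x = 0}"
    by (simp add: subspace_def add scaleR)
  from real_projection_exists[OF closed_kernel[OF assms] this, of x0]
  obtain p where p: "f p = 0" "\<And>k. f k = 0 \<Longrightarrow> inner (x0 - p) k = 0"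
    by auto
  define z where "z = x0 - p"
  have fz: "f z \<noteq> 0"
    using x0 p(1) by (simp add: z_def diff)
  then have "z \<noteq> 0"
    using zero by force
  have "inner ((f z / (norm z)\<^sup>2) *\<^sub>R z) x = f x" for x
  proof -
    \<comment> \<open>Removing this multiple of \<open>z\<close> from \<open>x\<close> leaves a
      vector in the kernel of \<open>f\<close>, to which \<open>z\<close> is orthogonal.\<close>
    have "inner z (x - (f x / f z) *\<^sub>R z) = 0"
      unfolding z_def using fz by (intro p(2)) (simp add: diff scaleR z_def)
    then have "inner z x = f x / f z * (norm z)\<^sup>2"
      by (simp add: inner_diff_right power2_norm_eq_inner)
    then show ?thesis
      using fz \<open>z \<noteq> 0\<close> by simp
  qed
  then show ?thesis by blast
qed

text \<open>The real projection onto a complex subspace is already orthogonal in the complex sense,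
  because the subspace contains the multiples of its elements by i. The last property, uniqueness,
  yields linearity here and the commutation of a projection with the dilation later.\<close>

lemma cprojection_exists:
  fixes S :: "'a::chilbert_space set"
  assumes "closed S" "csubspace S"
  obtains P where "bounded_clinear P" "\<And>x. P x \<in> S" "\<And>x k. k \<in> S \<Longrightarrow> cinner k (x - P x) = 0"
    "\<And>x q. q \<in> S \<Longrightarrow> (\<And>k. k \<in> S \<Longrightarrow> cinner k (x - q) = 0) \<Longrightarrow> P x = q"
proof -
  have "\<exists>p\<in>S. \<forall>k\<in>S. cinner k (x - p) = 0" for x
  proof -
    obtain p where p: "p \<in> S" "\<And>k. k \<in> S \<Longrightarrow> inner (x - p) k = 0"
      using real_projection_exists[OF assms(1) csubspaceD(1)[OF assms(2)], of x] by blast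
    have "cinner (x - p) k = cinner 0 k" if "k \<in> S" for k
      using that csubspaceD(5)[OF assms(2) that] by (intro cinner_eq_if_inner_eq) (simp_all add: p(2))
    then show ?thesis
      using p(1) by (metis cinner_eq_0_commute cinner_zero_left)
  qed
  then obtain P where P: "\<And>x. P x \<in> S" "\<And>x k. k \<in> S \<Longrightarrow> cinner k (x - P x) = 0"
    by metis
  have unique: "P x = q" if "q \<in> S" "\<And>k. k \<in> S \<Longrightarrow> cinner k (x - q) = 0" for x q
  proof -
    have "cinner (P x - q) (P x - q) = cinner (P x - q) (x - q) - cinner (P x - q) (x - P x)"
      by (simp flip: cinner_diff_right)
    also have "\<dots> = 0"
      using that P csubspaceD(4)[OF assms(2)] by simp
    finally show ?thesis by simp
  qed
  have "bounded_clinear P"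
  proof (rule bounded_clinearI[where K = 1])
    fix x y
    show "P (x + y) = P x + P y"
    proof (rule unique)
      fix k assume "k \<in> S"
      have "x + y - (P x + P y) = (x - P x) + (y - P y)" by simp
      then show "cinner k (x + y - (P x + P y)) = 0"
        using P(2)[OF \<open>k \<in> S\<close>] by (simp only: cinner_add_right) simp
    qed (intro csubspaceD(3)[OF assms(2)] P)
  next
    fix c x
    show "P (c *\<^sub>C x) = c *\<^sub>C P x"
      by (rule unique)
        (auto simp: P csubspaceD(5)[OF assms(2)] cinner_scaleC_right simp flip: scaleC_diff_right)
  next
    fix x
    have "inner (P x) (x - P x) = 0"
      using P by (simp add: inner_eq_Re_cinner)
    then have "norm (P x) * norm (P x) = inner (P x) x"
      by (simp add: inner_diff_right flip: power2_norm_eq_inner power2_eq_square)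
    also have "\<dots> \<le> norm (P x) * norm x"
      by (rule norm_cauchy_schwarz)
    finally show "norm (P x) \<le> norm x * 1"
      by (cases "P x = 0") simp_all
  qed
  from that[OF this P unique] show ?thesis .
qed

section \<open>Adjoints\<close>

lemma cadjoint_eqI:
  assumes "\<And>x y. cinner (S y) x = cinner y (T x)"
  shows "cadjoint T = S"
  unfolding cadjoint_def
proof (rule the_equality)
  fix R assume "\<forall>x y. cinner (R y) x = cinner y (T x)"
  then have "R y = S y" for y
    by - (rule cinner_eqI_left, simp add: assms)
  then show "R = S"
    by blast
qed (simp add: assms)

lemma cinner_cadjoint_left:
  fixes T :: "'a::chilbert_space \<Rightarrow> 'b::complex_inner"
  assumes "bounded_clinear T"
  shows "cinner (cadjoint T y) x = cinner y (T x)"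
proof -
  note T = bounded_clinearD[OF assms]
  have "\<exists>z. \<forall>x. cinner z x = cinner y (T x)" for y
  proof -
    have "bounded_linear (\<lambda>x. inner y (T x))"
      by (rule bounded_linear_compose[OF bounded_linear_inner_right T(1)])
    then obtain z where "\<And>x. inner z x = inner y (T x)"
      using riesz_real by blast
    then have "cinner z x = cinner y (T x)" for x
      by (intro cinner_eq_if_inner_eq) (simp_all flip: T(5))
    then show ?thesis by blast
  qed
  then obtain S where S: "\<And>x y. cinner (S y) x = cinner y (T x)"
    by metis
  from cadjoint_eqI[of S T, OF S] show ?thesis
    by (simp add: S)
qed

lemma cinner_cadjoint_right:
  fixes T :: "'a::chilbert_space \<Rightarrow> 'b::complex_inner"
  assumes "bounded_clinear T"
  shows "cinner x (cadjoint T y) = cinner (T x) y"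
  using cinner_cadjoint_left[OF assms, of y x] by (metis cinner_commute)

lemma bounded_clinear_cadjoint:
  fixes T :: "'a::chilbert_space \<Rightarrow> 'b::complex_inner"
  assumes "bounded_clinear T"
  shows "bounded_clinear (cadjoint T)"
proof -
  obtain K where K: "\<And>x. norm (T x) \<le> norm x * K" "K \<ge> 0"
    using bounded_linear.nonneg_bounded[OF bounded_clinearD(1)[OF assms]] by blast
  show ?thesis
  proof (rule bounded_clinearI[where K = K])
    fix y
    let ?z = "cadjoint T y"
    have "complex_of_real (norm ?z * norm ?z) = cinner y (T ?z)"
      using cinner_self[of ?z] by (simp add: cinner_cadjoint_left[OF assms] power2_eq_square)
    then have "norm ?z * norm ?z = norm (cinner y (T ?z))"
      by (metis abs_of_nonneg norm_of_real norm_ge_zero mult_nonneg_nonneg)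
    also have "\<dots> \<le> norm y * norm (T ?z)"
      by (rule norm_cinner_le)
    also have "\<dots> \<le> norm y * (norm ?z * K)"
      by (intro mult_left_mono K) simp
    finally have "norm ?z * norm ?z \<le> (norm y * K) * norm ?z"
      by (simp add: mult_ac)
    then show "norm ?z \<le> norm y * K"
      using K(2) by (cases "?z = 0") simp_all
  qed (rule cinner_eqI_left, simp add: cinner_cadjoint_left[OF assms] cinner_add_left
      cinner_scaleC_left)+
qed

text \<open>Polarisation: the quadratic form is real at \<open>x + y\<close> and at
  \<open>x + \<i> *\<^sub>C y\<close>, which gives the imaginary and the real part of the
  claim.\<close>

lemma positive_op_selfadjoint:
  assumes "positive_op S"
  shows "cinner (S x) y = cinner x (S y)"
proof -
  note S = bounded_clinearD[of S]
  have lin: "bounded_clinear S" and im: "Im (cinner x (S x)) = 0" for x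
    using assms by (auto simp: positive_op_def complex_nonneg_Reals_iff)
  have "Im (cinner x (S y) + cinner y (S x)) = 0"
    using im[of "x + y"] im[of x] im[of y]
    by (simp add: S[OF lin] cinner_add_left cinner_add_right)
  moreover have "Re (cinner x (S y) - cinner y (S x)) = 0"
    using im[of "x + \<i> *\<^sub>C y"] im[of x] im[of y]
    by (simp add: S[OF lin] cinner_add_left cinner_add_right cinner_scaleC_left cinner_scaleC_right)
  ultimately have "cinner x (S y) = cnj (cinner y (S x))"
    by (simp add: complex_eq_iff)
  then show ?thesis
    by (simp flip: cinner_commute)
qed

text \<open>A projection is positive and equal to its square, hence a candidate. Conversely a
  positive root \<open>S\<close> vanishes on vectors \<open>P x - x\<close>, so
  \<open>S P = S\<close>; this makes \<open>P x - S x\<close> an eigenvector of \<open>S\<close> for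
  -1, and positivity leaves only zero.\<close>

lemma sqrt_op_projection:
  assumes P: "bounded_clinear P" "\<And>x. P (P x) = P x" "\<And>x y. cinner (P x) y = cinner x (P y)"
  shows "sqrt_op P = P"
  unfolding sqrt_op_def
proof (rule the_equality)
  have "cinner x (P x) = cinner (P x) (P x)" for x
    by (simp add: P(2,3))
  then show "positive_op P \<and> P \<circ> P = P"
    using P(1,2) by (auto simp: positive_op_def fun_eq_iff cinner_self complex_nonneg_Reals_iff)
next
  fix S assume "positive_op S \<and> S \<circ> S = P"
  then have S: "positive_op S" and SS: "\<And>x. S (S x) = P x"
    by (auto simp: fun_eq_iff)
  note lin = bounded_clinearD[of S]
  have bl: "bounded_clinear S" and nonneg: "Re (cinner x (S x)) \<ge> 0" for x
    using S by (auto simp: positive_op_def complex_nonneg_Reals_iff)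
  have SP: "S (P x) = S x" for x
  proof -
    have "cinner (S (P x - x)) (S (P x - x)) = cinner (P x - x) (P (P x - x))"
      by (simp add: positive_op_selfadjoint[OF S] SS)
    also have "\<dots> = 0"
      by (simp add: bounded_clinearD[OF P(1)] P(2))
    finally show ?thesis
      by (simp add: lin[OF bl])
  qed
  have "P x = S x" for x
  proof -
    let ?y = "P x - S x"
    have "S ?y = - ?y"
      by (simp add: lin[OF bl] SP SS)
    then have "0 \<le> Re (cinner ?y (- ?y))"
      using nonneg[of ?y] by simp
    then show ?thesis
      by (simp only: cinner_minus_right cinner_self) simp
  qed
  then show "S = P"
    by auto
qed

section \<open>Hilbert direct sums and Fock space\<close>

lemma cinner_ell2_single_left: "cinner (ell2_single i x) f = cinner x (ell2_nth f i)"
proof -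
  have "cinner (ell2_single i x) f
      = infsum (\<lambda>j. cinner (ell2_nth (ell2_single i x) j) (ell2_nth f j)) {i}"
    unfolding cinner_ell2_def
    by (rule infsum_cong_neutral) (auto simp: ell2_nth_single)
  then show ?thesis
    by (simp add: ell2_nth_single)
qed

lemma cinner_ell2_single_right: "cinner f (ell2_single i x) = cinner (ell2_nth f i) x"
  by (metis cinner_ell2_single_left cinner_commute)

lemma norm_ell2_single [simp]: "norm (ell2_single i x) = norm x"
proof -
  have "cinner (ell2_single i x) (ell2_single i x) = cinner x x"
    by (simp add: cinner_ell2_single_left ell2_nth_single)
  then have "(norm (ell2_single i x))\<^sup>2 = (norm x)\<^sup>2"
    by (simp only: cinner_self of_real_eq_iff)
  then show ?thesis
    by (simp add: power2_eq_iff_nonneg)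
qed

lemma bounded_clinear_ell2_single: "bounded_clinear (ell2_single i)"
  by (rule bounded_clinearI[where K = 1]) (auto intro!: ell2_eqI simp: ell2_nth_single)

lemma bounded_clinear_ell2_nth: "bounded_clinear (\<lambda>f::('i, 'a::complex_inner) ell2. ell2_nth f i)"
  by (rule bounded_clinearI[where K = 1]) (auto simp: norm_ell2_nth_le)

text \<open>By Pythagoras the error of the partial sum over \<open>F\<close> is the square root of
  the missing part of the norm series. The expansion lets bounded operators be evaluated coordinate
  by coordinate.\<close>

lemma has_sum_ell2_single:
  fixes f :: "('i, 'a::complex_inner) ell2"
  shows "((\<lambda>i. ell2_single i (ell2_nth f i)) has_sum f) UNIV"
proof -
  let ?s = "\<lambda>F. \<Sum>i\<in>F. ell2_single i (ell2_nth f i)"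
  have norm_diff: "norm (?s F - f) = sqrt ((norm f)\<^sup>2 - (\<Sum>i\<in>F. (norm (ell2_nth f i))\<^sup>2))"
    if "finite F" for F
  proof -
    have nth: "ell2_nth (?s F) j = (if j \<in> F then ell2_nth f j else 0)" for j
    proof -
      have "ell2_nth (?s F) j = (\<Sum>i\<in>F. ell2_nth (ell2_single i (ell2_nth f i)) j)"
        by (rule linear_sum[OF bounded_linear.linear])
          (rule bounded_clinearD(1)[OF bounded_clinear_ell2_nth])
      then show ?thesis
        using that by (simp add: ell2_nth_single)
    qed
    have inner_s: "inner g (?s F) = (\<Sum>i\<in>F. inner (ell2_nth g i) (ell2_nth f i))" for g
      unfolding inner_sum_right by (simp add: inner_eq_Re_cinner cinner_ell2_single_right)
    have "inner f (?s F) = (\<Sum>i\<in>F. (norm (ell2_nth f i))\<^sup>2)"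
      "inner (?s F) (?s F) = (\<Sum>i\<in>F. (norm (ell2_nth f i))\<^sup>2)"
      unfolding inner_s by (simp_all add: nth power2_norm_eq_inner)
    then have "(norm (?s F - f))\<^sup>2 = (norm f)\<^sup>2 - (\<Sum>i\<in>F. (norm (ell2_nth f i))\<^sup>2)"
      unfolding power2_norm_eq_inner by (simp add: inner_diff_left inner_diff_right inner_commute)
    then show ?thesis
      by (metis norm_ge_zero real_sqrt_unique)
  qed
  have "((\<lambda>i. (norm (ell2_nth f i))\<^sup>2) has_sum (norm f)\<^sup>2) UNIV"
    unfolding norm_ell2_sq by (intro has_sum_infsum ell2_summable)
  then have "((\<lambda>F. \<Sum>i\<in>F. (norm (ell2_nth f i))\<^sup>2) \<longlongrightarrow> (norm f)\<^sup>2) (finite_subsets_at_top UNIV)"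
    unfolding has_sum_def .
  then have "((\<lambda>F. sqrt ((norm f)\<^sup>2 - (\<Sum>i\<in>F. (norm (ell2_nth f i))\<^sup>2)))
      \<longlongrightarrow> sqrt ((norm f)\<^sup>2 - (norm f)\<^sup>2)) (finite_subsets_at_top UNIV)"
    by (intro tendsto_intros)
  then have "((\<lambda>F. sqrt ((norm f)\<^sup>2 - (\<Sum>i\<in>F. (norm (ell2_nth f i))\<^sup>2))) \<longlongrightarrow> 0)
      (finite_subsets_at_top UNIV)"
    by simp
  then have "((\<lambda>F. norm (?s F - f)) \<longlongrightarrow> 0) (finite_subsets_at_top UNIV)"
    by (rule tendsto_cong[THEN iffD1, rotated])
       (auto simp: eventually_finite_subsets_at_top norm_diff)
  then show ?thesis
    unfolding has_sum_def by (simp add: tendsto_norm_zero_iff flip: LIM_zero_iff[of _ f])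
qed

section \<open>Vacuum and creation operators\<close>

lemma fock_tensor_vacuum: "fock_tensor vacuum x = ell2_single [] x"
  by (rule ell2_eqI) (simp add: vacuum_def ell2_nth_single)

text \<open>Only words beginning with \<open>i\<close> contribute, and deleting that letter
  reindexes the sum.\<close>

lemma cinner_creation_left:
  "cinner (creation i \<xi>) \<eta> = (\<Sum>\<^sub>\<infinity>w. cinner (ell2_nth \<xi> w) (ell2_nth \<eta> (i # w)))"
proof -
  have "cinner (creation i \<xi>) \<eta>
      = (\<Sum>\<^sub>\<infinity>w\<in>range (Cons i). cinner (ell2_nth (creation i \<xi>) w) (ell2_nth \<eta> w))"
    unfolding cinner_ell2_def
    by (rule infsum_cong_neutral) (auto simp: ell2_nth_creation split: list.splits)
  also have "\<dots> = (\<Sum>\<^sub>\<infinity>w. cinner (ell2_nth \<xi> w) (ell2_nth \<eta> (i # w)))"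
    by (subst infsum_reindex) (auto simp: ell2_nth_creation o_def)
  finally show ?thesis .
qed

lemma cinner_creation_creation:
  "cinner (creation i \<xi>) (creation j \<eta>) = (if i = j then cinner \<xi> \<eta> else 0)"
  by (simp add: cinner_creation_left ell2_nth_creation cinner_ell2_def[of \<xi> \<eta>])

lemma bounded_clinear_creation: "bounded_clinear (creation i)"
proof (rule bounded_clinearI[where K = 1])
  fix \<xi> :: "('a list, 'b) ell2"
  have "cinner (creation i \<xi>) (creation i \<xi>) = cinner \<xi> \<xi>"
    by (simp add: cinner_creation_creation)
  then have "(norm (creation i \<xi>))\<^sup>2 = (norm \<xi>)\<^sup>2"
    by (simp only: cinner_self of_real_eq_iff)
  then show "norm (creation i \<xi>) \<le> norm \<xi> * 1"
    by (simp add: power2_eq_iff_nonneg)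
qed (auto intro!: ell2_eqI simp: ell2_nth_creation split: list.split)

lemma cinner_creation_vacuum: "cinner (creation i \<xi>) (fock_tensor vacuum x) = 0"
  by (simp add: fock_tensor_vacuum cinner_ell2_single_right ell2_nth_creation)

lemma csubspace_fock_over:
  assumes "csubspace D"
  shows "csubspace (fock_over D)"
  by (rule csubspaceI) (auto simp: fock_over_def csubspaceD[OF assms])

lemma closed_fock_over:
  assumes "closed D"
  shows "closed (fock_over D :: ('i list, 'k::complex_inner) ell2 set)"
proof -
  have "(fock_over D :: ('i list, 'k) ell2 set) = (\<Inter>w. (\<lambda>\<xi>. ell2_nth \<xi> w) -` D)"
    by (auto simp: fock_over_def)
  then show ?thesis
    by (simp only:) (intro closed_INT ballI closed_vimage_bounded_linear assms bounded_clinearD(1)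
        bounded_clinear_ell2_nth)
qed

section \<open>Coisometric rows and their dilations\<close>

locale coisometry =
  fixes A :: "'i \<Rightarrow> 'a::chilbert_space \<Rightarrow> 'a"
  assumes coisometric: "coisometric_row A"
begin

lemma bounded_clinear_A: "bounded_clinear (A i)"
  using coisometric by (simp add: coisometric_row_def)

lemma has_sum_A_adjoint: "((\<lambda>i. A i (cadjoint (A i) x)) has_sum x) UNIV"
  using coisometric by (simp add: coisometric_row_def)

lemma has_sum_norm_adjoint: "((\<lambda>i. (norm (cadjoint (A i) h))\<^sup>2) has_sum (norm h)\<^sup>2) UNIV"
proof -
  have "((\<lambda>i. inner h (A i (cadjoint (A i) h))) has_sum inner h h) UNIV"
    by (rule has_sum_bounded_linear[OF bounded_linear_inner_right has_sum_A_adjoint])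
  moreover have "inner h (A i (cadjoint (A i) h)) = (norm (cadjoint (A i) h))\<^sup>2" for i
    unfolding inner_eq_Re_cinner
    by (simp add: cinner_self flip: cinner_cadjoint_left[OF bounded_clinear_A])
  ultimately show ?thesis
    by (simp add: power2_norm_eq_inner)
qed

text \<open>The adjoint of the row operator, defined first because coisometry makes it visibly
  isometric. The row operator is then recovered as its adjoint.\<close>

definition col :: "'a \<Rightarrow> ('i, 'a) ell2"
  where "col h = Abs_ell2 (\<lambda>i. cadjoint (A i) h)"

lemma ell2_nth_col [simp]: "ell2_nth (col h) i = cadjoint (A i) h"
  unfolding col_def using has_sum_norm_adjoint[of h]
  by (subst ell2_nth_Abs) (auto simp: summable_on_def)

lemma bounded_clinear_col: "bounded_clinear col"
proof (rule bounded_clinearI[where K = 1])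
  fix h
  have "(norm (col h))\<^sup>2 = (norm h)\<^sup>2"
    using infsumI[OF has_sum_norm_adjoint[of h]] by (simp add: norm_ell2_sq)
  then show "norm (col h) \<le> norm h * 1"
    by (simp add: power2_eq_iff_nonneg)
qed (auto intro!: ell2_eqI simp: bounded_clinearD[OF bounded_clinear_cadjoint[OF bounded_clinear_A]])

text \<open>The adjoint of \<open>col\<close> is bounded and takes the value \<open>A i x\<close> on
  coordinate vectors, so applying it to the coordinate expansion of the argument gives convergence
  and the value at once.\<close>

lemma has_sum_row: "((\<lambda>i. A i (ell2_nth \<xi> i)) has_sum cadjoint col \<xi>) UNIV"
proof -
  have "cadjoint col (ell2_single i x) = A i x" for i x
    by (rule cinner_eqI_left) (simp add: cinner_cadjoint_left[OF bounded_clinear_col]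
        cinner_ell2_single_left cinner_cadjoint_right[OF bounded_clinear_A])
  then show ?thesis
    using has_sum_bounded_linear[OF bounded_clinearD(1)[OF
        bounded_clinear_cadjoint[OF bounded_clinear_col]] has_sum_ell2_single, of \<xi>] by simp
qed

lemma row_operator_eq: "row_operator A = cadjoint col"
  using infsumI[OF has_sum_row] by (auto simp: row_operator_def)

lemma bounded_clinear_row: "bounded_clinear (row_operator A)"
  unfolding row_operator_eq by (rule bounded_clinear_cadjoint[OF bounded_clinear_col])

lemma cinner_col_left: "cinner (col h) \<xi> = cinner h (row_operator A \<xi>)"
  by (simp add: row_operator_eq cinner_cadjoint_right[OF bounded_clinear_col])

lemma cinner_col_right: "cinner \<xi> (col h) = cinner (row_operator A \<xi>) h"
  by (simp add: row_operator_eq cinner_cadjoint_left[OF bounded_clinear_col])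

lemma row_col [simp]: "row_operator A (col h) = h"
  using has_sum_unique[OF has_sum_row[of "col h"]] has_sum_A_adjoint[of h]
  by (simp add: row_operator_eq)

lemma row_single [simp]: "row_operator A (ell2_single i h) = A i h"
  by (rule cinner_eqI_right) (simp add: cinner_ell2_single_right
      cinner_cadjoint_left[OF bounded_clinear_A] flip: cinner_col_left)

text \<open>Since \<open>row_operator A (col h) = h\<close>, the operator under the square root is a
  self-adjoint projection, hence its own root.\<close>

lemma defect_op_eq: "defect_op A \<xi> = \<xi> - col (row_operator A \<xi>)"
proof -
  have "cadjoint (row_operator A) = col"
    by (rule cadjoint_eqI) (rule cinner_col_left)
  moreover have "sqrt_op (\<lambda>\<xi>. \<xi> - col (row_operator A \<xi>)) = (\<lambda>\<xi>. \<xi> - col (row_operator A \<xi>))"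
    by (rule sqrt_op_projection)
      (simp_all add: bounded_clinear_diff bounded_clinear_ident bounded_clinear_compose
        bounded_clinear_col bounded_clinear_row bounded_clinearD[OF bounded_clinear_row]
        bounded_clinearD[OF bounded_clinear_col]
        cinner_diff_left cinner_diff_right cinner_col_left cinner_col_right)
  ultimately show ?thesis
    by (simp add: defect_op_def)
qed

lemma bounded_clinear_defect_op: "bounded_clinear (defect_op A)"
  unfolding defect_op_eq[abs_def]
  by (intro bounded_clinear_diff bounded_clinear_ident bounded_clinear_compose[OF bounded_clinear_col]
      bounded_clinear_row)

lemma row_defect_op [simp]: "row_operator A (defect_op A \<xi>) = 0"
  by (simp add: defect_op_eq bounded_clinearD[OF bounded_clinear_row])

lemma cinner_defect_op: "cinner (defect_op A \<xi>) \<eta> = cinner \<xi> (defect_op A \<eta>)"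
  by (simp add: defect_op_eq cinner_diff_left cinner_diff_right cinner_col_left cinner_col_right)

lemma defect_space_eq: "defect_space A = {\<xi>. row_operator A \<xi> = 0}"
proof -
  have "\<xi> \<in> range (defect_op A)" if "row_operator A \<xi> = 0" for \<xi>
    using that by (intro range_eqI[of _ _ \<xi>]) (simp add: defect_op_eq bounded_clinearD[OF bounded_clinear_col])
  then show ?thesis
    by (auto simp: defect_space_def)
qed

lemma defect_op_defect_space: "\<xi> \<in> defect_space A \<Longrightarrow> defect_op A \<xi> = \<xi>"
  by (simp add: defect_space_eq defect_op_eq bounded_clinearD[OF bounded_clinear_col])

lemma csubspace_defect_space: "csubspace (defect_space A)"
  unfolding defect_space_eq
  by (rule csubspaceI) (simp_all add: bounded_clinearD[OF bounded_clinear_row])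

lemma closed_defect_space: "closed (defect_space A)"
  unfolding defect_space_eq by (rule closed_kernel[OF bounded_clinearD(1)[OF bounded_clinear_row]])

text \<open>\<open>defect_op A\<close> is self-adjoint and fixes \<open>x\<close>, so the pairing
  reads off a coordinate. In particular the defect vectors of the coordinate vectors separate the
  points of the defect space.\<close>

lemma cinner_defect_single:
  assumes "x \<in> defect_space A"
  shows "cinner (defect_op A (ell2_single i h)) x = cinner h (ell2_nth x i)"
  using defect_op_defect_space[OF assms] by (simp add: cinner_defect_op cinner_ell2_single_left)

section \<open>The dilation space and its isometries\<close>

lemma csubspace_dilation_space: "csubspace (dilation_space A)"
  by (rule csubspaceI) (auto simp: dilation_space_def scaleC_prod_def zero_prod_def
      csubspaceD[OF csubspace_fock_over[OF csubspace_defect_space]])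

lemma closed_dilation_space: "closed (dilation_space A)"
  unfolding dilation_space_def
  by (intro closed_Times closed_UNIV closed_fock_over closed_defect_space)

lemma dilation_eq:
  "dilation A i z
    = (A i (fst z), ell2_single [] (defect_op A (ell2_single i (fst z))) + creation i (snd z))"
  by (simp add: dilation_def case_prod_unfold fock_tensor_vacuum)

lemma bounded_clinear_dilation: "bounded_clinear (dilation A i)"
  unfolding dilation_eq[abs_def]
  by (intro bounded_clinear_Pair bounded_clinear_add bounded_clinear_compose[OF bounded_clinear_A]
      bounded_clinear_compose[OF bounded_clinear_ell2_single]
      bounded_clinear_compose[OF bounded_clinear_defect_op]
      bounded_clinear_compose[OF bounded_clinear_creation] bounded_clinear_fst bounded_clinear_snd)

lemma dilation_in_dilation_space:
  assumes "z \<in> dilation_space A"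
  shows "dilation A i z \<in> dilation_space A"
  using assms csubspaceD[OF csubspace_defect_space]
  by (auto simp: dilation_space_def dilation_eq fock_over_def ell2_nth_single ell2_nth_creation
      defect_space_def split: list.split)

text \<open>Isometries with mutually orthogonal ranges: the defect components contribute the inner
  product of the coordinate vectors minus \<open>cinner (A i h) (A j g)\<close>, which cancels the
  contribution of the first components.\<close>

lemma cinner_dilation_dilation:
  "cinner (dilation A i z) (dilation A j z') = (if i = j then cinner z z' else 0)"
proof -
  have "cinner (defect_op A (ell2_single i h)) (defect_op A (ell2_single j g))
      = (if i = j then cinner h g else 0) - cinner (A i h) (A j g)" for h g
    by (simp add: cinner_defect_op[of "ell2_single i h"] defect_op_eq[of "defect_op A x" for x]
       defect_op_eq[of "ell2_single j g"] bounded_clinearD[OF bounded_clinear_row] 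
        bounded_clinearD[OF bounded_clinear_col] cinner_diff_right
        cinner_col_right cinner_ell2_single_left ell2_nth_single cinner_cadjoint_right[OF bounded_clinear_A])
  then show ?thesis
    using cinner_creation_vacuum[of i "snd z"] cinner_creation_vacuum[of j "snd z'"]
    by (simp add: dilation_eq cinner_prod_def cinner_add_left cinner_add_right
        cinner_ell2_single_left cinner_ell2_single_right ell2_nth_single ell2_nth_creation
        cinner_creation_creation)
qed

text \<open>Recovers a vector of the original space from its images under the adjoints, which later
  turns commutation with the dilation into the fixed-point equation of
  \<open>row_map A\<close>.\<close>

lemma has_sum_dilation_adjoint:
  "((\<lambda>i. dilation A i (cadjoint (A i) h, 0)) has_sum (h, 0)) UNIV"
proof -
  \<comment> \<open>On a coordinate vector \<open>ell2_single i h\<close> this is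
    \<open>dilation A i (h, 0)\<close>. At \<open>col h\<close> the second component vanishes and
    the first is \<open>h\<close>.\<close>
  let ?T = "\<lambda>\<xi>. (row_operator A \<xi>, ell2_single [] (defect_op A \<xi>))"
  have "bounded_linear ?T"
    by (intro bounded_clinearD(1) bounded_clinear_Pair bounded_clinear_row
        bounded_clinear_compose[OF bounded_clinear_ell2_single] bounded_clinear_defect_op)
  from has_sum_bounded_linear[OF this has_sum_ell2_single[of "col h"]]
  show ?thesis
    by (simp add: dilation_eq defect_op_eq[of "col h"] bounded_clinearD[OF bounded_clinear_creation]
        bounded_clinearD[OF bounded_clinear_ell2_single])
qed

end

section \<open>Unitaries from Gram matrices\<close>

lemma closed_cspan_orthogonal:
  assumes "\<And>w. cinner (u w) z = 0" "k \<in> closed_cspan u"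
  shows "cinner k z = 0"
proof -
  have "closed_cspan u \<subseteq> {y. cinner z y = 0}"
    by (intro closed_cspan_minimal csubspace_orthogonal closed_kernel bounded_linear_cinner_right)
      (simp add: cinner_eq_0_commute[of z] assms(1))
  then show ?thesis
    using assms(2) by (auto simp: cinner_eq_0_commute[of k])
qed

lemma csubspace_image:
  assumes "bounded_clinear f" "csubspace S"
  shows "csubspace (f ` S)"
proof (rule csubspaceI)
  show "0 \<in> f ` S"
    using csubspaceD(2)[OF assms(2)] bounded_clinearD(4)[OF assms(1)] by (metis imageI)
qed (auto simp flip: bounded_clinearD(2,5)[OF assms(1)] intro: csubspaceD[OF assms(2)])

text \<open>The lower bound makes the image complete, hence closed, so it contains the closed span
  of the images of the generators.\<close>

lemma image_closed_cspan:
  fixes p :: "'w \<Rightarrow> 'a::chilbert_space"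
  assumes f: "bounded_clinear f" and "e > 0"
    and e: "\<And>z. z \<in> closed_cspan p \<Longrightarrow> e * norm z \<le> norm (f z)"
  shows "f ` closed_cspan p = closed_cspan (\<lambda>w. f (p w))"
proof
  have "closed_cspan p \<subseteq> f -` closed_cspan (\<lambda>w. f (p w))"
    using in_closed_cspan[of "\<lambda>w. f (p w)"]
    by (intro closed_cspan_minimal csubspace_vimage f csubspace_closed_cspan
        closed_vimage_bounded_linear closed_closed_cspan bounded_clinearD(1)[OF f]) auto
  then show "f ` closed_cspan p \<subseteq> closed_cspan (\<lambda>w. f (p w))"
    by blast
next
  have "complete (f ` closed_cspan p)"
    using \<open>e > 0\<close> e
    by (intro complete_isometric_image[where e = e] bounded_clinearD(1)[OF f]
        csubspaceD(1)[OF csubspace_closed_cspan])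
      (auto simp: complete_eq_closed closed_closed_cspan)
  then show "closed_cspan (\<lambda>w. f (p w)) \<subseteq> f ` closed_cspan p"
    by (intro closed_cspan_minimal csubspace_image f csubspace_closed_cspan complete_imp_closed)
      (auto intro: in_closed_cspan)
qed

text \<open>The unitary is obtained through its graph, the closed span of the pairs \<open>(u w, v w)\<close>: both
  coordinate projections are isometric up to a factor there, so they have closed range.\<close>

lemma unitary_from_gram:
  fixes u :: "'w \<Rightarrow> 'a::chilbert_space" and v :: "'w \<Rightarrow> 'b::chilbert_space"
  assumes gram: "\<And>w w'. cinner (u w) (u w') = cinner (v w) (v w')"
  obtains W where "unitary_between (closed_cspan u) (closed_cspan v) W" "\<And>w. W (u w) = v w"
proof -
  define G where "G = closed_cspan (\<lambda>w. (u w, v w))"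
  have G: "csubspace G"
    unfolding G_def by (rule csubspace_closed_cspan)
  \<comment> \<open>The form whose vanishing on \<open>G\<close> says that the graph is isometric.
    It vanishes on pairs of generators and is extended to \<open>G\<close> in one argument at a
    time, exchanging the arguments by \<open>q_sym\<close>.\<close>
  let ?q = "\<lambda>z z'. cinner (fst z) (fst z') - cinner (snd z) (snd z')"
  have q_sym: "?q z z' = 0 \<longleftrightarrow> ?q z' z = 0" for z z' :: "'a \<times> 'b"
    by (metis cinner_commute right_minus_eq)
  have q_closed: "\<forall>z'\<in>G. ?q z z' = 0" if "\<And>w. ?q z (u w, v w) = 0" for z
  proof -
    have "csubspace {z'. ?q z z' = 0}"
      by (rule csubspaceI) (auto simp: cinner_add_right cinner_scaleC_right scaleC_prod_def)
    moreover have "closed {z'. ?q z z' = 0}"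
      by (intro closed_kernel bounded_linear_sub bounded_linear_compose[OF bounded_linear_cinner_right]
          bounded_linear_fst bounded_linear_snd)
    ultimately show ?thesis
      unfolding G_def using closed_cspan_minimal[of "{z'. ?q z z' = 0}" "\<lambda>w. (u w, v w)"] that
      by auto
  qed
  have "\<forall>z'\<in>G. ?q (u w, v w) z' = 0" for w
    by (rule q_closed) (simp add: gram)
  then have "\<forall>z'\<in>G. ?q z z' = 0" if "z \<in> G" for z
    using that q_sym by (intro q_closed) blast
  then have iso: "cinner (fst z) (fst z') = cinner (snd z) (snd z')" if "z \<in> G" "z' \<in> G" for z z'
    using that by auto
  have norm_eq: "norm (fst z) = norm (snd z)" if "z \<in> G" for z
  proof -
    have "(norm (fst z))\<^sup>2 = (norm (snd z))\<^sup>2"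
      using iso[OF that that] by (simp only: cinner_self of_real_eq_iff)
    then show ?thesis
      by (simp add: power2_eq_iff_nonneg)
  qed
  \<comment> \<open>The norm of a pair is at most the sum of the norms of its components, which are
    equal on \<open>G\<close>.\<close>
  have half: "1/2 * norm z \<le> norm (fst z)" "1/2 * norm z \<le> norm (snd z)" if "z \<in> G" for z
    using norm_Pair_le[of "fst z" "snd z"] norm_eq[OF that] by auto
  have inj: "inj_on fst G" "inj_on snd G"
  proof -
    have "z = z'" if "z \<in> G" "z' \<in> G" "fst z = fst z' \<or> snd z = snd z'" for z z'
      using half[OF csubspaceD(4)[OF G that(1,2)]] that(3) by auto
    then show "inj_on fst G" "inj_on snd G"
      by (auto intro!: inj_onI)
  qed
  have "fst ` G = closed_cspan u" "snd ` G = closed_cspan v"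
    using image_closed_cspan[OF bounded_clinear_fst, of "1/2" "\<lambda>w. (u w, v w)"]
      image_closed_cspan[OF bounded_clinear_snd, of "1/2" "\<lambda>w. (u w, v w)"] half
    by (simp_all add: G_def)
  then have bij: "bij_betw fst G (closed_cspan u)" "bij_betw snd G (closed_cspan v)"
    using inj by (simp_all add: bij_betw_def)
  define W where "W = snd \<circ> inv_into G fst"
  have W_fst: "W (fst z) = snd z" if "z \<in> G" for z
    using inj that by (simp add: W_def)
  have graph: "\<exists>z\<in>G. x = fst z" if "x \<in> closed_cspan u" for x
    using bij(1) that by (auto simp: bij_betw_def)
  have "unitary_between (closed_cspan u) (closed_cspan v) W"
    unfolding unitary_between_def
  proof (intro conjI ballI allI)
    show "bij_betw W (closed_cspan u) (closed_cspan v)"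
      unfolding W_def by (rule bij_betw_trans[OF bij_betw_inv_into[OF bij(1)] bij(2)])
  next
    fix x y assume "x \<in> closed_cspan u" "y \<in> closed_cspan u"
    then obtain z z' where z: "z \<in> G" "z' \<in> G" "x = fst z" "y = fst z'"
      using graph by blast
    show "W (x + y) = W x + W y"
      using z W_fst[OF csubspaceD(3)[OF G z(1,2)]] by (simp add: W_fst)
    show "cinner (W x) (W y) = cinner x y"
      using z iso by (simp add: W_fst)
  next
    fix c x assume "x \<in> closed_cspan u"
    then obtain z where z: "z \<in> G" "x = fst z"
      using graph by blast
    show "W (c *\<^sub>C x) = c *\<^sub>C W x"
      using z W_fst[OF csubspaceD(5)[OF G z(1)], of c] by (simp add: W_fst scaleC_prod_def)
  qed
  moreover have "W (u w) = v w" for w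
    using W_fst[of "(u w, v w)"] in_closed_cspan[of "\<lambda>w. (u w, v w)" w] by (simp add: G_def)
  ultimately show ?thesis
    by (rule that)
qed

lemma unitary_betweenD:
  assumes "unitary_between S T U"
  shows "x \<in> S \<Longrightarrow> U x \<in> T" "inj_on U S" "t \<in> T \<Longrightarrow> \<exists>x\<in>S. U x = t"
    "x \<in> S \<Longrightarrow> y \<in> S \<Longrightarrow> U (x + y) = U x + U y"
    "x \<in> S \<Longrightarrow> U (c *\<^sub>C x) = c *\<^sub>C U x"
    "x \<in> S \<Longrightarrow> y \<in> S \<Longrightarrow> cinner (U x) (U y) = cinner x y"
  using assms unfolding unitary_between_def bij_betw_def by auto

section \<open>The vacuum generates the dilation space\<close>

text \<open>The vectors \<open>V_w \<Omega>\<close>. The first component of a dilated vector depends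
  only on the first component of the argument, so \<open>fst\<close> gives
  \<open>A_w \<Omega>\<close>.\<close>

primrec orbit ::
    "('i \<Rightarrow> 'a::complex_inner \<Rightarrow> 'a) \<Rightarrow> 'a \<Rightarrow> 'i list \<Rightarrow> 'a \<times> ('i list, ('i, 'a) ell2) ell2"
  where
    "orbit A \<Omega> [] = (\<Omega>, 0)"
  | "orbit A \<Omega> (i # w) = dilation A i (orbit A \<Omega> w)"

locale ergodic_coisometry = coisometry A
  for A :: "'i \<Rightarrow> 'a::chilbert_space \<Rightarrow> 'a" +
  fixes \<Omega> :: 'a and \<omega> :: "'i \<Rightarrow> complex"
  assumes ergodic: "ergodic_row A"
    and norm_vacuum: "norm \<Omega> = 1"
    and eigenvector: "cadjoint (A i) \<Omega> = cnj (\<omega> i) *\<^sub>C \<Omega>"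
begin

lemma orbit_in_dilation_space: "orbit A \<Omega> w \<in> dilation_space A"
proof (induction w)
  case Nil
  then show ?case
    by (simp add: dilation_space_def fock_over_def csubspaceD[OF csubspace_defect_space])
qed (simp add: dilation_in_dilation_space)

lemma cinner_vacuum_vacuum: "cinner (orbit A \<Omega> []) (orbit A \<Omega> []) = 1"
  by (simp add: cinner_prod_def cinner_self norm_vacuum)

text \<open>Stands in for the adjoint of \<open>V_i\<close>, which sends the vacuum to
  \<open>cnj (\<omega> i)\<close> times itself, and \<open>V_j V_v \<Omega>\<close> to
  \<open>V_v \<Omega>\<close> if \<open>j = i\<close> and to zero otherwise. Pairings with orbit
  vectors thus obey a recursion whose coefficients come from \<open>\<omega>\<close> only.\<close>

lemma cinner_orbit_dilation:
  "cinner (orbit A \<Omega> w) (dilation A i z) =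
    (case w of [] \<Rightarrow> \<omega> i * cinner (orbit A \<Omega> []) z
      | j # v \<Rightarrow> if j = i then cinner (orbit A \<Omega> v) z else 0)"
  by (simp add: cinner_dilation_dilation split: list.split)
    (simp add: cinner_prod_def dilation_eq eigenvector cinner_scaleC_left
      flip: cinner_cadjoint_left[OF bounded_clinear_A])

lemma dilation_in_closed_cspan_orbit:
  assumes "z \<in> closed_cspan (orbit A \<Omega>)"
  shows "dilation A i z \<in> closed_cspan (orbit A \<Omega>)"
proof -
  have "closed_cspan (orbit A \<Omega>) \<subseteq> dilation A i -` closed_cspan (orbit A \<Omega>)"
    by (intro closed_cspan_minimal csubspace_vimage closed_vimage_bounded_linear
        bounded_clinear_dilation bounded_clinearD(1) csubspace_closed_cspan closed_closed_cspan)
      (use in_closed_cspan[of "orbit A \<Omega>" "i # w" for w] in simp)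
  then show ?thesis
    using assms by blast
qed

text \<open>The compression \<open>X\<close> of the projection \<open>P\<close> is scalar by
  ergodicity, and its value at \<open>\<Omega>\<close> makes the scalar 1. A projection that
  preserves the first component of \<open>(h, 0)\<close> must fix this vector.\<close>

lemma vacuum_generates: "(h, 0) \<in> closed_cspan (orbit A \<Omega>)"
proof -
  define K where "K = closed_cspan (orbit A \<Omega>)"
  have K: "closed K" "csubspace K"
    by (simp_all add: K_def closed_closed_cspan csubspace_closed_cspan)
  have orbit_K: "orbit A \<Omega> w \<in> K" for w
    by (simp add: K_def in_closed_cspan)
  obtain P where P: "bounded_clinear P" "\<And>x. P x \<in> K" "\<And>x k. k \<in> K \<Longrightarrow> cinner k (x - P x) = 0"
    "\<And>x q. q \<in> K \<Longrightarrow> (\<And>k. k \<in> K \<Longrightarrow> cinner k (x - q) = 0) \<Longrightarrow> P x = q"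
    using cprojection_exists[OF K] by blast
  \<comment> \<open>By uniqueness of projections it suffices that the isometry preserves both
    \<open>K\<close> and its orthogonal complement. The latter follows from
    \<open>cinner_orbit_dilation\<close>.\<close>
  have commute: "P (dilation A i z) = dilation A i (P z)" for i z
  proof (rule P(4))
    show "dilation A i (P z) \<in> K"
      using P(2) unfolding K_def by (rule dilation_in_closed_cspan_orbit)
    fix k assume "k \<in> K"
    have "cinner (orbit A \<Omega> w) (z - P z) = 0" for w
      by (rule P(3)[OF orbit_K])
    then have "cinner (orbit A \<Omega> w) (dilation A i (z - P z)) = 0" for w
      unfolding cinner_orbit_dilation by (auto split: list.split simp del: orbit.simps)
    then have "cinner k (dilation A i (z - P z)) = 0"
      using \<open>k \<in> K\<close> unfolding K_def by (rule closed_cspan_orthogonal)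
    then show "cinner k (dilation A i z - dilation A i (P z)) = 0"
      by (simp add: bounded_clinearD[OF bounded_clinear_dilation])
  qed
  define X where "X = (\<lambda>h. fst (P (h, 0)))"
  have lin: "bounded_clinear (\<lambda>z. fst (P z))"
    by (rule bounded_clinear_compose[OF bounded_clinear_fst P(1)])
  have "row_map A X h = X h" for h
  proof -
    have "((\<lambda>i. fst (P (dilation A i (cadjoint (A i) h, 0)))) has_sum X h) UNIV"
      unfolding X_def
      by (rule has_sum_bounded_linear[OF bounded_clinearD(1)[OF lin] has_sum_dilation_adjoint])
    then show ?thesis
      unfolding row_map_def X_def commute by (simp add: dilation_eq infsumI)
  qed
  moreover have "bounded_clinear X"
    unfolding X_def by (rule bounded_clinear_compose[OF lin bounded_clinear_Pair_left])
  ultimately obtain c where c: "X = (\<lambda>h. c *\<^sub>C h)"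
    using ergodic unfolding ergodic_row_def by blast
  have "P (\<Omega>, 0) = (\<Omega>, 0)"
    by (rule P(4)) (use orbit_K[of "[]"] in simp_all)
  then have "c *\<^sub>C \<Omega> = \<Omega>"
    using fun_cong[OF c, of \<Omega>] by (simp add: X_def)
  then have "c * cinner \<Omega> \<Omega> = cinner \<Omega> \<Omega>"
    by (metis cinner_scaleC_right)
  then have "c = 1"
    by (simp add: cinner_self norm_vacuum)
  then have fst_P: "fst (P (h, 0)) = h"
    using fun_cong[OF c, of h] by (simp add: X_def)
  \<comment> \<open>The first components of \<open>(h, 0)\<close> and \<open>P (h, 0)\<close> agree,
    so this inner product reduces to minus the squared norm of the second component.\<close>
  have "cinner (P (h, 0)) ((h, 0) - P (h, 0)) = 0"
    by (rule P(3)[OF P(2)])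
  then have "cinner (snd (P (h, 0))) (snd (P (h, 0))) = 0"
    by (simp add: cinner_diff_right cinner_prod_def fst_P cinner_minus_right del: cinner_self_eq_0)
  then have "P (h, 0) = (h, 0)"
    using fst_P by (simp add: prod_eq_iff)
  then show ?thesis
    using P(2)[of "(h, 0)"] by (simp add: K_def)
qed

text \<open>The closed span contains \<open>(h, 0)\<close> and \<open>dilation A i (h, 0)\<close>,
  hence by subtraction the defect vectors at the empty word; applying the isometries moves these to
  every word. Pairing with them reads off all coordinates of \<open>z\<close>.\<close>

lemma orbit_total:
  assumes z: "z \<in> dilation_space A" and orth: "\<And>w. cinner (orbit A \<Omega> w) z = 0"
  shows "z = 0"
proof -
  define K where "K = closed_cspan (orbit A \<Omega>)"
  have K: "csubspace K"
    by (simp add: K_def csubspace_closed_cspan)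
  have orth_K: "cinner k z = 0" if "k \<in> K" for k
    using closed_cspan_orthogonal[OF orth] that by (simp add: K_def)
  have base: "(h, 0) \<in> K" for h
    unfolding K_def by (rule vacuum_generates)
  have dil: "dilation A i k \<in> K" if "k \<in> K" for i k
    using that unfolding K_def by (rule dilation_in_closed_cspan_orbit)
  have fock: "(0, ell2_single w (defect_op A (ell2_single i h))) \<in> K" for w i h
  proof (induction w)
    case Nil
    have "dilation A i (h, 0) - (A i h, 0) \<in> K"
      by (intro csubspaceD(4)[OF K] dil base)
    then show ?case
      by (simp add: dilation_eq bounded_clinearD[OF bounded_clinear_creation])
  next
    case (Cons j w)
    have "creation j (ell2_single w x) = ell2_single (j # w) x" for x :: "('i, 'a) ell2"
      by (rule ell2_eqI) (auto simp: ell2_nth_single ell2_nth_creation split: list.split)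
    then show ?case
      using dil[OF Cons.IH, of j]
      by (simp add: dilation_eq bounded_clinearD[OF bounded_clinear_A]
          bounded_clinearD[OF bounded_clinear_ell2_single] bounded_clinearD[OF bounded_clinear_defect_op])
  qed
  have "fst z = 0"
    using orth_K[OF base[of "fst z"]] by (simp add: cinner_prod_def)
  moreover have "ell2_nth (ell2_nth (snd z) w) i = 0" for w i
  proof -
    let ?y = "ell2_nth (snd z) w"
    have "?y \<in> defect_space A"
      using z by (auto simp: dilation_space_def fock_over_def)
    then show ?thesis
      using orth_K[OF fock[of w i "ell2_nth ?y i"]]
      by (simp add: cinner_prod_def cinner_ell2_single_left cinner_defect_single)
  qed
  then have "snd z = 0"
    by (intro ell2_eqI) simp
  ultimately show ?thesis
    by (simp add: prod_eq_iff)
qed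

lemma orbit_eqI:
  assumes "z \<in> dilation_space A" "z' \<in> dilation_space A"
    and "\<And>w. cinner (orbit A \<Omega> w) z = cinner (orbit A \<Omega> w) z'"
  shows "z = z'"
  using orbit_total[of "z - z'"] assms csubspaceD(4)[OF csubspace_dilation_space]
  by (simp add: cinner_diff_right)

text \<open>The part of a vector of the dilation space orthogonal to the closed span vanishes by
  \<open>orbit_total\<close>.\<close>

lemma dilation_space_eq: "dilation_space A = closed_cspan (orbit A \<Omega>)"
proof
  show "closed_cspan (orbit A \<Omega>) \<subseteq> dilation_space A"
    by (intro closed_cspan_minimal csubspace_dilation_space closed_dilation_space
        orbit_in_dilation_space)
  obtain P where P: "\<And>x. P x \<in> closed_cspan (orbit A \<Omega>)"
    "\<And>x k. k \<in> closed_cspan (orbit A \<Omega>) \<Longrightarrow> cinner k (x - P x) = 0"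
    by (rule cprojection_exists[OF closed_closed_cspan[of "orbit A \<Omega>"] csubspace_closed_cspan])
      (rule that; assumption)
  show "dilation_space A \<subseteq> closed_cspan (orbit A \<Omega>)"
  proof
    fix z assume z: "z \<in> dilation_space A"
    have "P z \<in> dilation_space A"
      using P(1) \<open>closed_cspan (orbit A \<Omega>) \<subseteq> dilation_space A\<close> by blast
    then have "z - P z = 0"
      using z by (intro orbit_total csubspaceD(4)[OF csubspace_dilation_space] P(2) in_closed_cspan)
    then show "z \<in> closed_cspan (orbit A \<Omega>)"
      using P(1)[of z] by simp
  qed
qed

lemma closed_cspan_fst_orbit: "closed_cspan (\<lambda>w. fst (orbit A \<Omega> w)) = UNIV"
proof -
  let ?S = "closed_cspan (\<lambda>w. fst (orbit A \<Omega> w))"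
  have "closed_cspan (orbit A \<Omega>) \<subseteq> fst -` ?S"
    by (intro closed_cspan_minimal csubspace_vimage bounded_clinear_fst csubspace_closed_cspan
        closed_vimage_bounded_linear bounded_linear_fst closed_closed_cspan)
      (use in_closed_cspan[of "\<lambda>w. fst (orbit A \<Omega> w)"] in simp)
  then show ?thesis
    using vacuum_generates by fastforce
qed

lemma intertwiner_orbit:
  assumes "\<forall>i. \<forall>z\<in>dilation_space A. W (dilation A i z) = dilation B i (W z)" "W (\<Omega>, 0) = (\<Omega>', 0)"
  shows "W (orbit A \<Omega> w) = orbit B \<Omega>' w"
  using assms by (induction w) (simp_all add: orbit_in_dilation_space)

end

text \<open>The recursion \<open>cinner_orbit_dilation\<close> has the same coefficients for both
  rows, so induction on the words determines all inner products.\<close>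

lemma gram_orbit_eq:
  assumes A: "ergodic_coisometry A \<Omega>\<^sub>A \<omega>" and B: "ergodic_coisometry B \<Omega>\<^sub>B \<omega>"
  shows "cinner (orbit A \<Omega>\<^sub>A v) (orbit A \<Omega>\<^sub>A w) = cinner (orbit B \<Omega>\<^sub>B v) (orbit B \<Omega>\<^sub>B w)"
proof (induction w arbitrary: v)
  case Nil
  \<comment> \<open>The recursion removes letters from the right argument, so the base case is
    proved with the arguments exchanged and then conjugated.\<close>
  have "cinner (orbit A \<Omega>\<^sub>A []) (orbit A \<Omega>\<^sub>A v) = cinner (orbit B \<Omega>\<^sub>B []) (orbit B \<Omega>\<^sub>B v)"
  proof (induction v)
    case Nil
    show ?case
      using ergodic_coisometry.cinner_vacuum_vacuum[OF A]
        ergodic_coisometry.cinner_vacuum_vacuum[OF B] by simp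
  next
    case (Cons i v)
    then show ?case
      using ergodic_coisometry.cinner_orbit_dilation[OF A, of "[]"]
        ergodic_coisometry.cinner_orbit_dilation[OF B, of "[]"] by simp
  qed
  then show ?case
    by (metis cinner_commute)
next
  case (Cons i w)
  show ?case
    unfolding orbit.simps(2) ergodic_coisometry.cinner_orbit_dilation[OF A]
      ergodic_coisometry.cinner_orbit_dilation[OF B]
    using Cons.IH by (simp split: list.split del: orbit.simps)
qed

lemma cadjoint_scalar_row: "cadjoint (scalar_row \<omega> i) = (\<lambda>z. cnj (\<omega> i) * z)"
  by (rule cadjoint_eqI) (simp add: scalar_row_def cinner_complex_def)

text \<open>Ergodicity is automatic, since linear maps of the complex numbers are scalar. The target
  dilation thereby becomes an instance of the same locale, with its own total orbit.\<close>

lemma ergodic_coisometry_scalar_row: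
  assumes "((\<lambda>i. (cmod (\<omega> i))\<^sup>2) has_sum 1) UNIV"
  shows "ergodic_coisometry (scalar_row \<omega>) 1 \<omega>"
proof
  have "bounded_clinear (scalar_row \<omega> i)" for i
    by (rule bounded_clinearI[where K = "cmod (\<omega> i)"])
      (simp_all add: scalar_row_def distrib_left scaleC_complex_def norm_mult)
  moreover have "((\<lambda>i. \<omega> i * (cnj (\<omega> i) * x)) has_sum x) UNIV" for x
  proof -
    have "((\<lambda>i. complex_of_real ((cmod (\<omega> i))\<^sup>2) * x) has_sum complex_of_real 1 * x) UNIV"
      by (intro has_sum_cmult_left has_sum_of_real assms)
    then show ?thesis
      by (simp only: complex_norm_square mult.assoc of_real_1 mult_1)
  qed
  ultimately show "coisometric_row (scalar_row \<omega>)"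
    unfolding coisometric_row_def cadjoint_scalar_row by (simp add: scalar_row_def)
  have "X = (\<lambda>h. X 1 *\<^sub>C h)" if "bounded_clinear X" for X :: "complex \<Rightarrow> complex"
  proof
    show "X h = X 1 *\<^sub>C h" for h
      using bounded_clinearD(5)[OF that, of h 1] by (simp add: scaleC_complex_def mult.commute)
  qed
  then show "ergodic_row (scalar_row \<omega>)"
    unfolding ergodic_row_def by blast
qed (simp_all add: cadjoint_scalar_row scaleC_complex_def)

section \<open>The extended characteristic function\<close>

context ergodic_coisometry
begin

lemma ergodic_coisometry_omega: "ergodic_coisometry (scalar_row \<omega>) 1 \<omega>"
  using has_sum_norm_adjoint[of \<Omega>]
  by (intro ergodic_coisometry_scalar_row) (simp add: eigenvector norm_vacuum)

text \<open>An intertwiner maps orbit to orbit, so all pairings of \<open>W z\<close> with the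
  target orbit are known. By totality this determines \<open>W z\<close>.\<close>

lemma cinner_intertwiner:
  assumes "unitary_between (dilation_space A) S W"
    and "\<forall>i. \<forall>z\<in>dilation_space A. W (dilation A i z) = dilation B i (W z)" "W (\<Omega>, 0) = (\<Omega>', 0)"
    and "z \<in> dilation_space A"
  shows "cinner (orbit B \<Omega>' w) (W z) = cinner (orbit A \<Omega> w) z"
  using unitary_betweenD(6)[OF assms(1) orbit_in_dilation_space assms(4), of w]
    intertwiner_orbit[OF assms(2,3)] by simp

text \<open>Justifies the definite description. Existence comes from the common Gram matrix of the
  two orbits, and both the intertwining relation and uniqueness are checked by pairing with the
  target orbit.\<close>

lemma dilation_unitary:
  defines "W \<equiv> dilation_unitary A \<Omega> \<omega>"
  shows "unitary_between (dilation_space A) (dilation_space (scalar_row \<omega>)) W"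
    and "\<forall>i. \<forall>z\<in>dilation_space A. W (dilation A i z) = dilation (scalar_row \<omega>) i (W z)"
    and "W (\<Omega>, 0) = (1, 0)"
proof -
  interpret S: ergodic_coisometry "scalar_row \<omega>" 1 \<omega>
    by (rule ergodic_coisometry_omega)
  let ?P = "\<lambda>W. W \<in> extensional (dilation_space A) \<and>
    unitary_between (dilation_space A) (dilation_space (scalar_row \<omega>)) W \<and>
    (\<forall>i. \<forall>z\<in>dilation_space A. W (dilation A i z) = dilation (scalar_row \<omega>) i (W z)) \<and>
    W (\<Omega>, 0) = (1, 0)"
  obtain W0 where W0: "unitary_between (dilation_space A) (dilation_space (scalar_row \<omega>)) W0"
    "\<And>w. W0 (orbit A \<Omega> w) = orbit (scalar_row \<omega>) 1 w"
    by (rule unitary_from_gram[OF gram_orbit_eq[OF ergodic_coisometry_axioms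
            ergodic_coisometry_omega], of "\<lambda>w. w", folded dilation_space_eq S.dilation_space_eq])
      (rule that; assumption)
  have inner: "cinner (orbit (scalar_row \<omega>) 1 w) (W0 z) = cinner (orbit A \<Omega> w) z"
    if "z \<in> dilation_space A" for w z
    using unitary_betweenD(6)[OF W0(1) orbit_in_dilation_space that, of w] W0(2) by simp
  have intertwine: "W0 (dilation A i z) = dilation (scalar_row \<omega>) i (W0 z)"
    if z: "z \<in> dilation_space A" for i z
  proof (rule S.orbit_eqI)
    fix w
    show "cinner (orbit (scalar_row \<omega>) 1 w) (W0 (dilation A i z))
        = cinner (orbit (scalar_row \<omega>) 1 w) (dilation (scalar_row \<omega>) i (W0 z))"
      unfolding inner[OF dilation_in_dilation_space[OF z]] cinner_orbit_dilation
        S.cinner_orbit_dilation inner[OF z] ..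
  qed (use z in \<open>auto intro!: unitary_betweenD(1)[OF W0(1)] S.dilation_in_dilation_space
      dilation_in_dilation_space\<close>)
  \<comment> \<open>\<open>W0\<close> is arbitrary off the dilation space; restricting it supplies
    the required extensionality.\<close>
  have "?P (restrict W0 (dilation_space A))"
  proof (intro conjI allI ballI)
    show "unitary_between (dilation_space A) (dilation_space (scalar_row \<omega>))
        (restrict W0 (dilation_space A))"
      using W0(1) csubspaceD[OF csubspace_dilation_space]
      by (simp add: unitary_between_def bij_betw_restrict_eq)
    show "restrict W0 (dilation_space A) (\<Omega>, 0) = (1, 0)"
      using W0(2)[of "[]"] orbit_in_dilation_space[of "[]"] by simp
  qed (simp_all add: intertwine dilation_in_dilation_space)
  moreover have "W = W'" if W: "?P W" and W': "?P W'" for W W'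
  proof (rule extensionalityI)
    fix z assume z: "z \<in> dilation_space A"
    show "W z = W' z"
    proof (rule S.orbit_eqI)
      show "cinner (orbit (scalar_row \<omega>) 1 w) (W z) = cinner (orbit (scalar_row \<omega>) 1 w) (W' z)" for w
        using W W' z cinner_intertwiner by metis
    qed (use W W' z unitary_betweenD(1) in blast)+
  qed (use W W' in auto)
  ultimately have "\<exists>!W. ?P W"
    by blast
  from theI'[OF this] have "?P W"
    unfolding W_def dilation_unitary_def .
  then show "unitary_between (dilation_space A) (dilation_space (scalar_row \<omega>)) W"
    and "\<forall>i. \<forall>z\<in>dilation_space A. W (dilation A i z) = dilation (scalar_row \<omega>) i (W z)"
    and "W (\<Omega>, 0) = (1, 0)"
    by blast+
qed

lemma vacuum_tensor_in_dilation_space: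
  assumes "x \<in> defect_space A"
  shows "(0, fock_tensor vacuum x) \<in> dilation_space A"
  using assms csubspaceD(2)[OF csubspace_defect_space]
  by (auto simp: dilation_space_def fock_over_def fock_tensor_vacuum ell2_nth_single)

text \<open>Only the coordinate at the empty word matters. For \<open>V_i V_v \<Omega>\<close> it is
  the defect vector of \<open>A_v \<Omega>\<close> in position \<open>i\<close>, whose pairing with
  \<open>x\<close> reads off the coordinate of \<open>x\<close> there.\<close>

lemma cinner_orbit_vacuum_tensor:
  assumes "x \<in> defect_space A"
  shows "cinner (orbit A \<Omega> w) (0, fock_tensor vacuum x) =
    (case w of [] \<Rightarrow> 0 | i # v \<Rightarrow> cinner (fst (orbit A \<Omega> v)) (ell2_nth x i))"
  using assms
  by (auto simp: fock_tensor_vacuum cinner_prod_def cinner_ell2_single_right dilation_eq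
      ell2_nth_single ell2_nth_creation cinner_defect_single split: list.split)

text \<open>The unitary transports the pairings just computed. The one with the empty word shows
  that the first component of the image is zero, so taking \<open>snd\<close> in
  \<open>ext_char_fun\<close> loses nothing.\<close>

lemma
  assumes "x \<in> defect_space A"
  shows cinner_orbit_ext_char_fun: "cinner (orbit (scalar_row \<omega>) 1 w) (0, ext_char_fun A \<Omega> \<omega> x) =
      (case w of [] \<Rightarrow> 0 | i # v \<Rightarrow> cinner (fst (orbit A \<Omega> v)) (ell2_nth x i))"
    and ext_char_fun_in_dilation_space:
      "(0, ext_char_fun A \<Omega> \<omega> x) \<in> dilation_space (scalar_row \<omega>)"
proof -
  let ?z = "(0, fock_tensor vacuum x)"
  let ?Wz = "dilation_unitary A \<Omega> \<omega> ?z"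
  note z = vacuum_tensor_in_dilation_space[OF assms]
  have inner: "cinner (orbit (scalar_row \<omega>) 1 w) ?Wz = cinner (orbit A \<Omega> w) ?z" for w
    by (rule cinner_intertwiner[OF dilation_unitary z])
  have "fst ?Wz = 0"
    using inner[of "[]"] by (simp add: cinner_prod_def cinner_complex_def)
  then have Wz: "?Wz = (0, ext_char_fun A \<Omega> \<omega> x)"
    by (simp add: prod_eq_iff ext_char_fun_def)
  show "cinner (orbit (scalar_row \<omega>) 1 w) (0, ext_char_fun A \<Omega> \<omega> x) =
      (case w of [] \<Rightarrow> 0 | i # v \<Rightarrow> cinner (fst (orbit A \<Omega> v)) (ell2_nth x i))"
    using inner[of w] cinner_orbit_vacuum_tensor[OF assms, of w] by (simp only: Wz)
  show "(0, ext_char_fun A \<Omega> \<omega> x) \<in> dilation_space (scalar_row \<omega>)"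
    using unitary_betweenD(1)[OF dilation_unitary(1) z] by (simp only: Wz)
qed

text \<open>The part of \<open>g\<close> orthogonal to \<open>\<Omega>\<close> is again a common
  eigenvector. Moving the adjoints across one letter at a time makes it orthogonal to every
  \<open>A_w \<Omega>\<close>, hence zero.\<close>

lemma eigenvector_unique:
  assumes "\<And>i. cadjoint (A i) g = cnj (\<omega> i) *\<^sub>C g"
  shows "g = cinner \<Omega> g *\<^sub>C \<Omega>"
proof -
  let ?g = "g - cinner \<Omega> g *\<^sub>C \<Omega>"
  have eigen: "cadjoint (A i) ?g = cnj (\<omega> i) *\<^sub>C ?g" for i
    by (simp add: bounded_clinearD[OF bounded_clinear_cadjoint[OF bounded_clinear_A]] assms eigenvector
        scaleC_diff_right scaleC_scaleC mult.commute)
  have "cinner (orbit A \<Omega> w) (?g, 0) = 0" for w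
  proof (induction w)
    case Nil
    show ?case
      by (simp add: cinner_prod_def cinner_diff_right cinner_scaleC_right cinner_self norm_vacuum)
  next
    case (Cons i w)
    then have "cinner (fst (orbit A \<Omega> w)) ?g = 0"
      by (simp only: cinner_prod_def fst_conv snd_conv cinner_zero_right add_0_right)
    then show ?case
      by (simp only: orbit.simps cinner_prod_def fst_conv snd_conv cinner_zero_right add_0_right
          dilation_eq cinner_scaleC_right eigen mult_zero_right
          flip: cinner_cadjoint_right[OF bounded_clinear_A])
  qed
  moreover have "(?g, 0) \<in> dilation_space A"
    using closed_cspan_minimal vacuum_generates by (simp only: dilation_space_eq)
  ultimately have "(?g, 0) = (0 :: 'a \<times> ('i list, ('i, 'a) ell2) ell2)"
    by (intro orbit_total)
  then show ?thesis
    by (simp add: zero_prod_def)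
qed

end

lemma ext_char_fun_eq_iff:
  assumes A: "ergodic_coisometry A \<Omega>\<^sub>A \<omega>" and B: "ergodic_coisometry B \<Omega>\<^sub>B \<omega>"
    and x: "x \<in> defect_space A" and y: "y \<in> defect_space B"
  shows "ext_char_fun A \<Omega>\<^sub>A \<omega> x = ext_char_fun B \<Omega>\<^sub>B \<omega> y \<longleftrightarrow>
    (\<forall>v i. cinner (fst (orbit A \<Omega>\<^sub>A v)) (ell2_nth x i) = cinner (fst (orbit B \<Omega>\<^sub>B v)) (ell2_nth y i))"
    (is "?l \<longleftrightarrow> ?r")
proof
  interpret A: ergodic_coisometry A \<Omega>\<^sub>A \<omega> by (rule A)
  interpret B: ergodic_coisometry B \<Omega>\<^sub>B \<omega> by (rule B)
  interpret S: ergodic_coisometry "scalar_row \<omega>" 1 \<omega> by (rule A.ergodic_coisometry_omega)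
  {
    assume ?l
    then show ?r
      using A.cinner_orbit_ext_char_fun[OF x, of "i # v" for i v]
        B.cinner_orbit_ext_char_fun[OF y, of "i # v" for i v] by simp
  next
    assume ?r
    then have "(0, ext_char_fun A \<Omega>\<^sub>A \<omega> x) = (0 :: complex, ext_char_fun B \<Omega>\<^sub>B \<omega> y)"
      by (intro S.orbit_eqI A.ext_char_fun_in_dilation_space B.ext_char_fun_in_dilation_space x y)
        (simp add: A.cinner_orbit_ext_char_fun[OF x] B.cinner_orbit_ext_char_fun[OF y]
          split: list.split del: orbit.simps)
    then show ?l
      by simp
  }
qed

section \<open>The characteristic function as a complete invariant\<close>

lemma unitary_between_imp_norm:
  assumes "unitary_between S T U" "x \<in> S"
  shows "norm (U x) = norm x"
proof -
  have "(norm (U x))\<^sup>2 = (norm x)\<^sup>2"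
    using unitary_betweenD(6)[OF assms assms(2)] by (simp only: cinner_self of_real_eq_iff)
  then show ?thesis
    by (simp add: power2_eq_iff_nonneg)
qed

lemma unitary_between_imp_bounded_clinear:
  assumes "unitary_between UNIV UNIV U"
  shows "bounded_clinear U"
  by (rule bounded_clinearI[where K = 1])
    (simp_all add: unitary_betweenD[OF assms] unitary_between_imp_norm[OF assms])

text \<open>Applying \<open>U\<close> in every coordinate intertwines the row operators, so it
  carries the kernel of one, which is its defect space, onto that of the other.\<close>

lemma defect_unitary_exists:
  fixes A :: "'i \<Rightarrow> 'a::chilbert_space \<Rightarrow> 'a" and B :: "'i \<Rightarrow> 'b::chilbert_space \<Rightarrow> 'b"
  assumes "coisometry A" "coisometry B"
    and U: "unitary_between UNIV UNIV U" and intertwine: "\<And>i h. U (A i h) = B i (U h)"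
  shows "\<exists>V. unitary_between (defect_space A) (defect_space B) V \<and>
    (\<forall>x i. ell2_nth (V x) i = U (ell2_nth x i))"
proof -
  interpret A: coisometry A by fact
  interpret B: coisometry B by fact
  note lin = unitary_between_imp_bounded_clinear[OF U]
  define V :: "('i, 'a) ell2 \<Rightarrow> ('i, 'b) ell2"
    where "V x = Abs_ell2 (\<lambda>i. U (ell2_nth x i))" for x
  have nth: "ell2_nth (V x) i = U (ell2_nth x i)" for x i
    unfolding V_def using ell2_summable[of x]
    by (subst ell2_nth_Abs) (simp_all add: unitary_between_imp_norm[OF U])
  have row: "row_operator B (V x) = U (row_operator A x)" for x
  proof -
    have "((\<lambda>i. B i (ell2_nth (V x) i)) has_sum U (row_operator A x)) UNIV"
      using has_sum_bounded_linear[OF bounded_clinearD(1)[OF lin] A.has_sum_row]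
      by (simp add: intertwine nth A.row_operator_eq)
    then show ?thesis
      using has_sum_unique[OF B.has_sum_row] by (simp add: B.row_operator_eq)
  qed
  have U_eq_0: "U h = 0 \<longleftrightarrow> h = 0" for h
    using unitary_between_imp_norm[OF U, of h] by (metis norm_eq_zero UNIV_I)
  have V_defect: "V x \<in> defect_space B \<longleftrightarrow> x \<in> defect_space A" for x
    by (simp add: A.defect_space_eq B.defect_space_eq row U_eq_0)
  have "unitary_between (defect_space A) (defect_space B) V"
    unfolding unitary_between_def
  proof (intro conjI ballI allI)
    have "inj_on V (defect_space A)"
    proof (rule inj_onI)
      fix x x' assume "V x = V x'"
      then have "U (ell2_nth x i) = U (ell2_nth x' i)" for i
        by (metis nth)
      then show "x = x'"
        using unitary_betweenD(2)[OF U] by (intro ell2_eqI) (auto dest: injD)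
    qed
    moreover have "\<exists>x\<in>defect_space A. V x = y" if "y \<in> defect_space B" for y
    proof -
      have surj: "U (inv U h) = h" for h
        using unitary_betweenD(3)[OF U] by (metis UNIV_I f_inv_into_f rangeI)
      have "norm (inv U h) = norm h" for h
        by (metis surj unitary_between_imp_norm[OF U UNIV_I])
      then have "ell2_nth (Abs_ell2 (\<lambda>i. inv U (ell2_nth y i))) i = inv U (ell2_nth y i)" for i
        using ell2_summable[of y] by (subst ell2_nth_Abs) simp_all
      then have "V (Abs_ell2 (\<lambda>i. inv U (ell2_nth y i))) = y"
        by (intro ell2_eqI) (simp add: nth surj)
      then show ?thesis
        using that V_defect by metis
    qed
    ultimately show "bij_betw V (defect_space A) (defect_space B)"
      using V_defect by (auto simp: bij_betw_def)
  qed (auto intro!: ell2_eqI simp: nth bounded_clinearD[OF lin]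
      cinner_ell2_def[of "V x" for x] cinner_ell2_def[of x for x :: "('i, 'a) ell2"]
      unitary_betweenD(6)[OF U])
  with nth show ?thesis
    by blast
qed

lemma ext_char_fun_equivalent_if_unitarily_equivalent:
  assumes A: "ergodic_coisometry A \<Omega>\<^sub>A \<omega>" and B: "ergodic_coisometry B \<Omega>\<^sub>B \<omega>"
    and U: "unitary_between UNIV UNIV U" and intertwine: "\<And>i h. U (A i h) = B i (U h)"
  shows "\<exists>V. unitary_between (defect_space A) (defect_space B) V \<and>
    (\<forall>x\<in>defect_space A. ext_char_fun A \<Omega>\<^sub>A \<omega> x = ext_char_fun B \<Omega>\<^sub>B \<omega> (V x))"
proof -
  interpret A: ergodic_coisometry A \<Omega>\<^sub>A \<omega> by (rule A)
  interpret B: ergodic_coisometry B \<Omega>\<^sub>B \<omega> by (rule B)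
  \<comment> \<open>As a common eigenvector with the same eigenvalues, the image of the vacuum must
    be a multiple of the other vacuum.\<close>
  have "cadjoint (B i) (U \<Omega>\<^sub>A) = cnj (\<omega> i) *\<^sub>C U \<Omega>\<^sub>A" for i
  proof (rule cinner_eqI_right)
    fix g
    obtain h where g: "g = U h"
      using unitary_betweenD(3)[OF U, of g] by blast
    have "cinner (U h) (cadjoint (B i) (U \<Omega>\<^sub>A)) = cinner (U (A i h)) (U \<Omega>\<^sub>A)"
      by (simp add: cinner_cadjoint_right[OF B.bounded_clinear_A] intertwine)
    also have "\<dots> = cinner h (cadjoint (A i) \<Omega>\<^sub>A)"
      by (simp add: unitary_betweenD(6)[OF U] cinner_cadjoint_right[OF A.bounded_clinear_A])
    also have "\<dots> = cinner (U h) (cnj (\<omega> i) *\<^sub>C U \<Omega>\<^sub>A)"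
      by (simp add: A.eigenvector cinner_scaleC_right unitary_betweenD(6)[OF U])
    finally show "cinner g (cadjoint (B i) (U \<Omega>\<^sub>A)) = cinner g (cnj (\<omega> i) *\<^sub>C U \<Omega>\<^sub>A)"
      by (simp only: g)
  qed
  then obtain c where c: "U \<Omega>\<^sub>A = c *\<^sub>C \<Omega>\<^sub>B"
    using B.eigenvector_unique by blast
  have "norm c = 1"
    using arg_cong[OF c, of norm]
    by (simp add: unitary_between_imp_norm[OF U] A.norm_vacuum B.norm_vacuum)
  then have cc: "cnj c * c = 1"
    by (metis complex_norm_square mult.commute of_real_1 one_power2)
  \<comment> \<open>The factor cancels the phase \<open>c\<close>, so that vacuum goes to vacuum,
    while unitarity and the intertwining relation persist.\<close>
  define U' where "U' h = cnj c *\<^sub>C U h" for h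
  have U': "unitary_between UNIV UNIV U'"
    unfolding unitary_between_def
  proof (intro conjI ballI allI)
    have "bij (\<lambda>h. cnj c *\<^sub>C h :: 'c)"
      using cc by (intro o_bij[of "\<lambda>h. c *\<^sub>C h"]) (simp_all add: fun_eq_iff scaleC_scaleC mult.commute)
    then show "bij U'"
      using bij_comp[of U "\<lambda>h. cnj c *\<^sub>C h"] U
      by (simp add: U'_def[abs_def] unitary_between_def comp_def)
    show "cinner (U' x) (U' y) = cinner x y" for x y
      using cc by (simp add: U'_def cinner_scaleC_left cinner_scaleC_right unitary_betweenD(6)[OF U]
          mult.commute flip: mult.assoc)
  qed (simp_all add: U'_def unitary_betweenD[OF U] scaleC_add_right scaleC_scaleC mult.commute)
  have intertwine': "U' (A i h) = B i (U' h)" for i h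
    by (simp add: U'_def intertwine bounded_clinearD[OF B.bounded_clinear_A])
  have "U' \<Omega>\<^sub>A = \<Omega>\<^sub>B"
    using cc by (simp add: U'_def c scaleC_scaleC)
  then have orbit: "fst (orbit B \<Omega>\<^sub>B v) = U' (fst (orbit A \<Omega>\<^sub>A v))" for v
    by (induction v) (simp_all add: A.dilation_eq B.dilation_eq intertwine')
  obtain V where V: "unitary_between (defect_space A) (defect_space B) V"
    "\<And>x i. ell2_nth (V x) i = U' (ell2_nth x i)"
    using defect_unitary_exists[OF A.coisometry_axioms B.coisometry_axioms U'] intertwine' by metis
  have "ext_char_fun A \<Omega>\<^sub>A \<omega> x = ext_char_fun B \<Omega>\<^sub>B \<omega> (V x)" if "x \<in> defect_space A" for x
    unfolding ext_char_fun_eq_iff[OF A B that unitary_betweenD(1)[OF V(1) that]]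
    by (simp add: V(2) orbit unitary_betweenD(6)[OF U'])
  with V(1) show ?thesis
    by blast
qed

lemma unitarily_equivalent_if_ext_char_fun_equivalent:
  assumes A: "ergodic_coisometry A \<Omega>\<^sub>A \<omega>" and B: "ergodic_coisometry B \<Omega>\<^sub>B \<omega>"
    and V: "unitary_between (defect_space A) (defect_space B) V"
    and equiv: "\<And>x. x \<in> defect_space A \<Longrightarrow> ext_char_fun A \<Omega>\<^sub>A \<omega> x = ext_char_fun B \<Omega>\<^sub>B \<omega> (V x)"
  shows "\<exists>U. unitary_between UNIV UNIV U \<and> (\<forall>i h. U (A i h) = B i (U h))"
proof -
  interpret A: ergodic_coisometry A \<Omega>\<^sub>A \<omega> by (rule A)
  interpret B: ergodic_coisometry B \<Omega>\<^sub>B \<omega> by (rule B)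
  define a where "a v = fst (orbit A \<Omega>\<^sub>A v)" for v
  define b where "b v = fst (orbit B \<Omega>\<^sub>B v)" for v
  have matrix_coeff: "cinner (a v) (ell2_nth x i) = cinner (b v) (ell2_nth (V x) i)"
    if x: "x \<in> defect_space A" for x v i
    using equiv[OF x] ext_char_fun_eq_iff[OF A B x unitary_betweenD(1)[OF V x]]
    by (simp add: a_def b_def)
  have V_defect: "V (defect_op A (ell2_single i (a v))) = defect_op B (ell2_single i (b v))"
    (is "?p = ?q") for i v
  proof -
    let ?p' = "defect_op A (ell2_single i (a v))"
    have p': "?p' \<in> defect_space A"
      by (simp add: defect_space_def)
    have "?p - ?q \<in> defect_space B"
      by (intro csubspaceD(4)[OF B.csubspace_defect_space] unitary_betweenD(1)[OF V p'])
        (simp add: defect_space_def)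
    \<comment> \<open>By surjectivity the difference itself lies in the image of \<open>V\<close>.
      It is therefore enough to compare both vectors against images \<open>V x\<close>, where
      \<open>matrix_coeff\<close> applies.\<close>
    then obtain x where x: "x \<in> defect_space A" "?p - ?q = V x"
      using unitary_betweenD(3)[OF V] by metis
    have "cinner ?p (V x) = cinner ?q (V x)"
      using x(1) by (simp add: unitary_betweenD[OF V] p' A.cinner_defect_single
          B.cinner_defect_single matrix_coeff)
    then have "cinner (?p - ?q) (?p - ?q) = 0"
      by (simp only: x(2)[symmetric] cinner_diff_left right_minus_eq)
    then show ?thesis
      by simp
  qed
  have V_zero: "V 0 = 0"
    using unitary_betweenD(5)[OF V csubspaceD(2)[OF A.csubspace_defect_space], of 0] by simp
  have in_defect: "ell2_nth (snd (orbit A \<Omega>\<^sub>A w)) u \<in> defect_space A" for w u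
    using A.orbit_in_dilation_space[of w] by (auto simp: dilation_space_def fock_over_def)
  \<comment> \<open>At the empty word the coordinate is a defect vector handled by
    \<open>V_defect\<close>. At a longer word it is zero or a coordinate of the preceding orbit
    vector.\<close>
  have V_orbit: "V (ell2_nth (snd (orbit A \<Omega>\<^sub>A w)) u) = ell2_nth (snd (orbit B \<Omega>\<^sub>B w)) u" for w u
  proof (induction w arbitrary: u)
    case (Cons i w)
    then show ?case
      using V_defect by (simp add: A.dilation_eq B.dilation_eq ell2_nth_single ell2_nth_creation V_zero
          a_def b_def split: list.split)
  qed (simp add: V_zero)
  have "cinner (snd (orbit A \<Omega>\<^sub>A v)) (snd (orbit A \<Omega>\<^sub>A w))
      = cinner (snd (orbit B \<Omega>\<^sub>B v)) (snd (orbit B \<Omega>\<^sub>B w))" for v w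
    unfolding cinner_ell2_def[of "snd (orbit A \<Omega>\<^sub>A v)"] cinner_ell2_def[of "snd (orbit B \<Omega>\<^sub>B v)"]
    by (simp only: V_orbit[symmetric] unitary_betweenD(6)[OF V in_defect in_defect])
  then have gram: "cinner (a v) (a w) = cinner (b v) (b w)" for v w
    using gram_orbit_eq[OF A B, of v w] by (simp add: cinner_prod_def a_def b_def)
  obtain U where U: "unitary_between (closed_cspan a) (closed_cspan b) U" "\<And>v. U (a v) = b v"
    by (rule unitary_from_gram[OF gram]) (rule that; assumption)
  have "closed_cspan a = UNIV"
    unfolding a_def[abs_def] using A.closed_cspan_fst_orbit .
  moreover have "closed_cspan b = UNIV"
    unfolding b_def[abs_def] using B.closed_cspan_fst_orbit .
  ultimately have U_UNIV: "unitary_between UNIV UNIV U"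
    using U(1) by simp
  note lin = unitary_between_imp_bounded_clinear[OF U_UNIV]
  have "U (A i h) = B i (U h)" for i h
  proof -
    \<comment> \<open>Both terms send \<open>a v\<close> to \<open>b (i # v)\<close>, and the kernel
      of their difference is a closed subspace, hence everything.\<close>
    let ?D = "\<lambda>h. U (A i h) - B i (U h)"
    have D: "bounded_clinear ?D"
      by (intro bounded_clinear_diff bounded_clinear_compose[OF lin A.bounded_clinear_A]
          bounded_clinear_compose[OF B.bounded_clinear_A lin])
    have "closed_cspan a \<subseteq> {h. ?D h = 0}"
    proof (rule closed_cspan_minimal)
      show "csubspace {h. ?D h = 0}"
        using csubspace_vimage[OF D, of "{0}"] by (simp add: vimage_def csubspace_def)
      show "closed {h. ?D h = 0}"
        by (rule closed_kernel[OF bounded_clinearD(1)[OF D]])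
      have "U (A i (a v)) = U (a (i # v))" "B i (b v) = b (i # v)" for v
        by (simp_all add: a_def b_def A.dilation_eq B.dilation_eq)
      then show "a v \<in> {h. ?D h = 0}" for v
        by (simp add: U(2))
    qed
    then show ?thesis
      using \<open>closed_cspan a = UNIV\<close> by auto
  qed
  with U_UNIV show ?thesis
    by blast
qed

theorem theorem6p1:
  fixes A :: "'i::countable \<Rightarrow> 'a::chilbert_space \<Rightarrow> 'a"
    and B :: "'i \<Rightarrow> 'b::chilbert_space \<Rightarrow> 'b"
    and \<Omega>\<^sub>A :: 'a and \<Omega>\<^sub>B :: 'b and \<omega> :: "'i \<Rightarrow> complex"
  assumes "infinite (UNIV :: 'i set) \<or> 2 \<le> CARD('i)"
    and "separable_space (euclidean :: 'a topology)"
    and "separable_space (euclidean :: 'b topology)"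
    and "coisometric_row A" and "ergodic_row A"
    and "coisometric_row B" and "ergodic_row B"
    and "norm \<Omega>\<^sub>A = 1" and "norm \<Omega>\<^sub>B = 1"
    and "((\<lambda>i. (cmod (\<omega> i))\<^sup>2) has_sum 1) UNIV"
    and "\<And>i. cadjoint (A i) \<Omega>\<^sub>A = cnj (\<omega> i) *\<^sub>C \<Omega>\<^sub>A"
    and "\<And>i. cadjoint (B i) \<Omega>\<^sub>B = cnj (\<omega> i) *\<^sub>C \<Omega>\<^sub>B"
  shows "(\<exists>V. unitary_between (defect_space A) (defect_space B) V \<and>
            (\<forall>x\<in>defect_space A. ext_char_fun A \<Omega>\<^sub>A \<omega> x = ext_char_fun B \<Omega>\<^sub>B \<omega> (V x)))
         \<longleftrightarrow>
         (\<exists>U. unitary_between UNIV UNIV U \<and> (\<forall>i h. U (A i h) = B i (U h)))"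
proof -
  have A: "ergodic_coisometry A \<Omega>\<^sub>A \<omega>" and B: "ergodic_coisometry B \<Omega>\<^sub>B \<omega>"
    by (unfold_locales; fact)+
  show ?thesis
    using ext_char_fun_equivalent_if_unitarily_equivalent[OF A B]
      unitarily_equivalent_if_ext_char_fun_equivalent[OF A B] by blast
qed

end
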